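(* Let $n\ge 48$. Then there exists an intermediate field $\mathbf{Q}\subset L\subset \mathbf{Q}(x_1,\ldots,x_n)$ such that $L$ is minimal, $L$ is not rational over $\mathbf{Q}$, and the $\mathbf{Q}$-algebra $L\cap\mathbf{Q}[x_1,\ldots,x_n]$ is not finitely generated.
   Context: $\mathbf{Q}$ is the field of rational numbers, $\mathbf{Q}[x_1,\ldots,x_n]$ is the polynomial ring in $n$ variables, and $\mathbf{Q}(x_1,\ldots,x_n)$ is its field of fractions. A field extension $L/\mathbf{Q}$ is called rational if it is purely transcendental. An intermediate field $L$ is minimal if the transcendence degree over $\mathbf{Q}$ of $L\cap\mathbf{Q}[x_1,\ldots,x_n]$ equals that of $L$; equivalently, the field of fractions of $L\cap\mathbf{Q}[x_1,\ldots,x_n]$ is $L$. *)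

theory Defs
  imports
    "HOL-Library.Poly_Mapping"
    "HOL-Library.Extended_Nat"
    "HOL-Computational_Algebra.Fraction_Field"
    "HOL-Algebra.Generated_Fields"
    "HOL-Algebra.Algebraic_Closure_Type"
begin

text \<open>
  With this instance \<open>\<rat>\<close> denotes the prime field of any field of fractions of characteristic 0;
  in the field of rational functions below it is the field of constants.
\<close>

instance fract :: ("{idom, ring_char_0}") field_char_0
proof
  show "inj (of_nat :: nat \<Rightarrow> 'a fract)"
  proof (rule injI)
    fix m n :: nat
    assume eq: "(of_nat m :: 'a fract) = of_nat n"
    have "(of_nat m :: 'a fract) = Fract (of_nat m) 1" for m
      by (induction m) (simp_all add: Zero_fract_def One_fract_def)
    with eq have "Fract (of_nat m :: 'a) 1 = Fract (of_nat n) 1"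
      by metis
    then show "m = n"
      by (simp add: eq_fract)
  qed
qed


section \<open>Polynomials and rational functions\<close>

text \<open>
  The type \<open>(nat \<Rightarrow>\<^sub>0 nat) \<Rightarrow>\<^sub>0 rat\<close> is the polynomial ring over the rationals in the variables
  \<open>x\<^sub>0, x\<^sub>1, x\<^sub>2, \<dots>\<close>: a monomial is its finitely supported exponent function. Since the number \<open>n\<close>
  of variables is not part of the type, the rings in the variables \<open>x\<^sub>1, \<dots>, x\<^sub>n\<close> are cut out as
  subsets of its field of fractions.
\<close>

type_synonym ratfun = "((nat \<Rightarrow>\<^sub>0 nat) \<Rightarrow>\<^sub>0 rat) fract"

definition indets :: "(('i \<Rightarrow>\<^sub>0 nat) \<Rightarrow>\<^sub>0 'c::zero) \<Rightarrow> 'i set"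
  where "indets p = (\<Union>m\<in>Poly_Mapping.keys p. Poly_Mapping.keys m)"

definition polynomials :: "nat \<Rightarrow> ratfun set"
  where "polynomials n = {Fract p 1 | p. indets p \<subseteq> {1..n}}"

definition rational_functions :: "nat \<Rightarrow> ratfun set"
  where "rational_functions n =
    {Fract p q | p q. indets p \<subseteq> {1..n} \<and> indets q \<subseteq> {1..n} \<and> q \<noteq> 0}"


section \<open>Transcendence degree and purely transcendental extensions\<close>

definition poly_eval :: "('i \<Rightarrow> 'a) \<Rightarrow> (('i \<Rightarrow>\<^sub>0 nat) \<Rightarrow>\<^sub>0 'a) \<Rightarrow> 'a::comm_ring_1"
  where "poly_eval f p =
    (\<Sum>m\<in>Poly_Mapping.keys p. Poly_Mapping.lookup p m *
       (\<Prod>i\<in>Poly_Mapping.keys m. f i ^ Poly_Mapping.lookup m i))"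

text \<open>
  The elements of \<open>B\<close> serve as the names of the indeterminates of \<open>p\<close>, which are then evaluated
  at themselves. Here \<open>Poly_Mapping.range p\<close> is the set of non-zero coefficients of \<open>p\<close>.
\<close>

definition alg_independent :: "'a::field set \<Rightarrow> 'a set \<Rightarrow> bool"
  where "alg_independent K B \<longleftrightarrow>
    (\<forall>p :: ('a \<Rightarrow>\<^sub>0 nat) \<Rightarrow>\<^sub>0 'a.
       Poly_Mapping.range p \<subseteq> K \<longrightarrow> indets p \<subseteq> B \<longrightarrow> poly_eval (\<lambda>b. b) p = 0 \<longrightarrow> p = 0)"

text \<open>
  The set \<open>A\<close> may be any subalgebra over the field \<open>K\<close>, not just a field. Infinite transcendence
  degrees are not distinguished.
\<close>

definition trdeg :: "'a::field set \<Rightarrow> 'a set \<Rightarrow> enat"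
  where "trdeg K A = Sup {enat (card B) | B. B \<subseteq> A \<and> finite B \<and> alg_independent K B}"

definition purely_transcendental :: "'a::field set \<Rightarrow> 'a set \<Rightarrow> bool"
  where "purely_transcendental K L \<longleftrightarrow>
    (\<exists>B. alg_independent K B \<and> L = generate_field ring_of_type_algebra (K \<union> B))"


section \<open>Intermediate fields\<close>

definition finitely_generated_algebra :: "'a::field set \<Rightarrow> 'a set \<Rightarrow> bool"
  where "finitely_generated_algebra K A \<longleftrightarrow>
    (\<exists>S. finite S \<and> A = generate_ring ring_of_type_algebra (K \<union> S))"

definition intermediate_field :: "nat \<Rightarrow> ratfun set \<Rightarrow> bool"
  where "intermediate_field n L \<longleftrightarrow>
    subfield L ring_of_type_algebra \<and> \<rat> \<subseteq> L \<and> L \<subseteq> rational_functions n"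

definition minimal_field :: "nat \<Rightarrow> ratfun set \<Rightarrow> bool"
  where "minimal_field n L \<longleftrightarrow> trdeg \<rat> (L \<inter> polynomials n) = trdeg \<rat> L"

end

theory Submission
  imports Defs "HOL-Analysis.Continuum_Not_Denumerable"
begin

text \<open>
  Let \<open>A\<close> be the algebra of all polynomials that are annihilated by Roberts' derivation
  \<open>D = x\<^sup>3 \<partial>\<^sub>s + y\<^sup>3 \<partial>\<^sub>t + z\<^sup>3 \<partial>\<^sub>u + (x y z)\<^sup>2 \<partial>\<^sub>v\<close> and that are real-valued on a certain set of
  ``twisted'' complex points, which have real coordinates except for three further variables
  \<open>T, m, b\<close>, with \<open>T\<close> purely imaginary. Take \<open>L\<close> to be the field of fractions of \<open>A\<close>.

  The field \<open>L\<close> is minimal because a numerator or a denominator can be substituted for each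
  element of an algebraically independent subset of \<open>L\<close>, one at a time.

  A polynomial in the kernel of \<open>D\<close> contains no monomial \<open>v\<^sup>k\<close> with \<open>k > 0\<close>, but for every \<open>k\<close> some
  element of \<open>A\<close> contains \<open>x v\<^sup>k\<close>; finitely many generators only give finitely many \<open>k\<close>. The
  elements are \<open>\<Sum>\<^sub>j (-1)\<^sup>j v\<^sup>k\<^sup>-\<^sup>j g\<^sub>j / (k - j)!\<close> with \<open>g\<^sub>0 = x\<close> and \<open>D g\<^sub>j\<^sub>+\<^sub>1 = (x y z)\<^sup>2 g\<^sub>j\<close>, and the
  \<open>g\<^sub>j\<close> exist because a lowering operator of an \<open>sl\<^sub>2\<close>-representation is surjective below the
  middle weight.

  Finally \<open>A\<close> contains \<open>r = T\<^sup>2\<close>, \<open>v = b m\<close>, \<open>y = b (m\<^sup>2 + g)\<close> and \<open>w = T b (m\<^sup>2 - g)\<close> with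
  \<open>g = - (r + 1) (r + 2)\<close>, and these satisfy \<open>w\<^sup>2 = r (y\<^sup>2 + 4 (r + 1) (r + 2) v\<^sup>2)\<close>. The real
  points of this conic bundle lie in two parts, over \<open>r \<ge> 0\<close> and over \<open>-2 \<le> r \<le> -1\<close>. Generic
  real and generic twisted points embed \<open>L\<close> into the reals with \<open>r\<close> in the one and in the other
  part. If an algebraically independent set generated \<open>L\<close>, a straight line between its two images
  would connect the two parts.
\<close>

section \<open>Evaluation of multivariate polynomials\<close>

definition monomial_eval :: "('i \<Rightarrow> 'b::comm_monoid_mult) \<Rightarrow> ('i \<Rightarrow>\<^sub>0 nat) \<Rightarrow> 'b"
  where "monomial_eval f m = (\<Prod>i\<in>Poly_Mapping.keys m. f i ^ Poly_Mapping.lookup m i)"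

text \<open>Coefficients pass through \<open>h\<close>, unlike in \<open>poly_eval\<close>, so that
  one rational polynomial can be evaluated in the reals, the complex numbers and the field of
  rational functions.\<close>

definition insertion :: "('c::zero \<Rightarrow> 'b) \<Rightarrow> ('i \<Rightarrow> 'b) \<Rightarrow> (('i \<Rightarrow>\<^sub>0 nat) \<Rightarrow>\<^sub>0 'c) \<Rightarrow> 'b::comm_ring_1"
  where "insertion h f p =
    (\<Sum>m\<in>Poly_Mapping.keys p. h (Poly_Mapping.lookup p m) * monomial_eval f m)"

definition var :: "'i \<Rightarrow> ('i \<Rightarrow>\<^sub>0 nat) \<Rightarrow>\<^sub>0 'c::comm_ring_1"
  where "var i = Poly_Mapping.single (Poly_Mapping.single i 1) 1"

definition const :: "'c \<Rightarrow> ('i \<Rightarrow>\<^sub>0 nat) \<Rightarrow>\<^sub>0 'c::zero"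
  where "const a = Poly_Mapping.single 0 a"

lemma monomial_eval_superset:
  assumes "finite A" "Poly_Mapping.keys m \<subseteq> A"
  shows "monomial_eval f m = (\<Prod>i\<in>A. f i ^ Poly_Mapping.lookup m i)"
  unfolding monomial_eval_def using assms
  by (intro prod.mono_neutral_left) (auto simp: in_keys_iff)

lemma monomial_eval_0 [simp]: "monomial_eval f 0 = 1"
  by (simp add: monomial_eval_def)

lemma monomial_eval_single [simp]: "monomial_eval f (Poly_Mapping.single i k) = f i ^ k"
  by (cases "k = 0") (auto simp: monomial_eval_def)

lemma monomial_eval_add: "monomial_eval f (m + m') = monomial_eval f m * monomial_eval f m'"
proof -
  let ?A = "Poly_Mapping.keys m \<union> Poly_Mapping.keys m'"
  have "monomial_eval f (m + m') = (\<Prod>i\<in>?A. f i ^ Poly_Mapping.lookup (m + m') i)"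
    by (rule monomial_eval_superset) (use keys_add[of m m'] in auto)
  also have "\<dots> = (\<Prod>i\<in>?A. f i ^ Poly_Mapping.lookup m i) * (\<Prod>i\<in>?A. f i ^ Poly_Mapping.lookup m' i)"
    by (simp add: lookup_add power_add prod.distrib)
  also have "\<dots> = monomial_eval f m * monomial_eval f m'"
    by (subst (1 2) monomial_eval_superset[of ?A]) auto
  finally show ?thesis .
qed

lemma poly_mapping_sum_singles:
  "p = (\<Sum>m\<in>Poly_Mapping.keys p. Poly_Mapping.single m (Poly_Mapping.lookup p m))"
  by (rule poly_mapping_eqI)
    (auto simp: lookup_sum lookup_single when_def in_keys_iff intro: sum.neutral)

lemma poly_mapping_additive_induct [case_names single add]:
  assumes "\<And>m a. P (Poly_Mapping.single m a)" and "\<And>p q. P p \<Longrightarrow> P q \<Longrightarrow> P (p + q)"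
  shows "P (p :: 'a \<Rightarrow>\<^sub>0 'b::comm_monoid_add)"
proof -
  have "P (\<Sum>m\<in>A. Poly_Mapping.single m (Poly_Mapping.lookup p m))" if "finite A" for A
    using that
  proof induction
    case empty
    \<comment> \<open>A monomial with coefficient 0 is the zero polynomial, which saves a separate
      zero case.\<close>
    then show ?case using assms(1)[of undefined 0] by simp
  qed (auto intro: assms)
  from this[OF finite_keys] show ?thesis
    using poly_mapping_sum_singles[of p] by metis
qed

lemma insertion_superset:
  assumes "finite A" "Poly_Mapping.keys p \<subseteq> A" "h 0 = 0"
  shows "insertion h f p = (\<Sum>m\<in>A. h (Poly_Mapping.lookup p m) * monomial_eval f m)"
  unfolding insertion_def using assms
  by (intro sum.mono_neutral_left) (auto simp: in_keys_iff)

text \<open>These are the unital ring homomorphisms. Besides coefficient maps such as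
  \<open>of_rat\<close>, the embeddings of the function field into the complex numbers are treated
  as instances.\<close>

locale coeff_hom =
  fixes h :: "'c::comm_ring_1 \<Rightarrow> 'b::comm_ring_1"
  assumes hom_0 [simp]: "h 0 = 0" and hom_1 [simp]: "h 1 = 1"
    and hom_add: "h (a + b) = h a + h b" and hom_mult: "h (a * b) = h a * h b"
begin

lemma insertion_single [simp]: "insertion h f (Poly_Mapping.single m a) = h a * monomial_eval f m"
  by (cases "a = 0") (auto simp: insertion_def)

lemma insertion_var [simp]: "insertion h f (var i) = f i"
  by (simp add: var_def)

lemma insertion_const [simp]: "insertion h f (const a) = h a"
  by (simp add: const_def)

lemma insertion_0 [simp]: "insertion h f 0 = 0"
  by (simp add: insertion_def)

lemma insertion_1 [simp]: "insertion h f 1 = 1"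
  using insertion_single[of f 0 1] by simp

lemma insertion_add [simp]: "insertion h f (p + q) = insertion h f p + insertion h f q"
proof -
  let ?A = "Poly_Mapping.keys p \<union> Poly_Mapping.keys q"
  have "insertion h f (p + q) =
      (\<Sum>m\<in>?A. h (Poly_Mapping.lookup (p + q) m) * monomial_eval f m)"
    by (rule insertion_superset) (use keys_add[of p q] in auto)
  also have "\<dots> = (\<Sum>m\<in>?A. h (Poly_Mapping.lookup p m) * monomial_eval f m)
      + (\<Sum>m\<in>?A. h (Poly_Mapping.lookup q m) * monomial_eval f m)"
    by (simp add: lookup_add hom_add distrib_right sum.distrib)
  also have "\<dots> = insertion h f p + insertion h f q"
    by (subst (1 2) insertion_superset[of ?A]) auto
  finally show ?thesis .
qed

lemma insertion_mult [simp]: "insertion h f (p * q) = insertion h f p * insertion h f q"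
proof (induction p rule: poly_mapping_additive_induct)
  case (single m a)
  show ?case
  proof (induction q rule: poly_mapping_additive_induct)
    case (single m' b)
    show ?case by (simp add: mult_single hom_mult monomial_eval_add)
  qed (simp add: algebra_simps)
qed (simp add: algebra_simps)

lemma insertion_uminus [simp]: "insertion h f (- p) = - insertion h f p"
  by (metis add.right_inverse insertion_0 insertion_add minus_unique)

lemma insertion_diff [simp]: "insertion h f (p - q) = insertion h f p - insertion h f q"
  by (metis diff_conv_add_uminus insertion_add insertion_uminus)

lemma insertion_sum [simp]: "insertion h f (sum g A) = (\<Sum>a\<in>A. insertion h f (g a))"
  by (induction A rule: infinite_finite_induct) auto

lemma insertion_prod [simp]: "insertion h f (prod g A) = (\<Prod>a\<in>A. insertion h f (g a))"
  by (induction A rule: infinite_finite_induct) auto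

lemma insertion_power [simp]: "insertion h f (p ^ k) = insertion h f p ^ k"
  by (induction k) auto

lemma insertion_of_nat [simp]: "insertion h f (of_nat k) = of_nat k"
  by (induction k) auto

lemma insertion_numeral [simp]: "insertion h f (numeral k) = numeral k"
  using insertion_of_nat[of f "numeral k"] by simp

end

lemma insertion_cong:
  assumes "\<And>i. i \<in> indets p \<Longrightarrow> f i = g i"
  shows "insertion h f p = insertion h g p"
  unfolding insertion_def monomial_eval_def using assms
  by (intro sum.cong refl arg_cong2[where f = "(*)"] prod.cong arg_cong2[where f = "(^)"])
    (auto simp: indets_def)

lemma coeff_hom_of_rat: "coeff_hom (of_rat :: rat \<Rightarrow> 'a::field_char_0)"
  by unfold_locales (simp_all add: of_rat_add of_rat_mult)

global_interpretation of_rat: coeff_hom "of_rat :: rat \<Rightarrow> 'a::field_char_0"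
  by (rule coeff_hom_of_rat)

section \<open>Indeterminates of sums and products\<close>

lemma indets_add: "indets (p + q) \<subseteq> indets p \<union> indets q"
  using keys_add[of p q] by (auto simp: indets_def)

lemma indets_uminus [simp]: "indets (- p :: ('i \<Rightarrow>\<^sub>0 nat) \<Rightarrow>\<^sub>0 'c::ab_group_add) = indets p"
  by (auto simp: indets_def in_keys_iff)

lemma indets_diff: "indets (p - q :: ('i \<Rightarrow>\<^sub>0 nat) \<Rightarrow>\<^sub>0 'c::ab_group_add) \<subseteq> indets p \<union> indets q"
  using indets_add[of p "- q"] by simp

lemma indets_mult: "indets (p * q) \<subseteq> indets p \<union> indets (q :: ('i \<Rightarrow>\<^sub>0 nat) \<Rightarrow>\<^sub>0 'c::comm_ring_1)"
proof
  fix i assume "i \<in> indets (p * q)"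
  then obtain m where m: "m \<in> Poly_Mapping.keys (p * q)" "i \<in> Poly_Mapping.keys m"
    by (auto simp: indets_def)
  then obtain a b where "m = a + b" "a \<in> Poly_Mapping.keys p" "b \<in> Poly_Mapping.keys q"
    using keys_mult[of p q] by blast
  with m(2) show "i \<in> indets p \<union> indets q"
    using keys_add[of a b] by (auto simp: indets_def)
qed

lemma indets_0 [simp]: "indets 0 = {}"
  by (simp add: indets_def)

lemma indets_const [simp]: "indets (const a) = {}"
  by (auto simp: indets_def const_def split: if_splits)

lemma indets_1 [simp]: "indets (1 :: ('i \<Rightarrow>\<^sub>0 nat) \<Rightarrow>\<^sub>0 'c::comm_ring_1) = {}"
  by (simp add: indets_def)

lemma indets_var [simp]: "indets (var i :: ('i \<Rightarrow>\<^sub>0 nat) \<Rightarrow>\<^sub>0 'c::comm_ring_1) = {i}"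
  by (simp add: indets_def var_def)

lemma indets_numeral [simp]: "indets (numeral k :: ('i \<Rightarrow>\<^sub>0 nat) \<Rightarrow>\<^sub>0 'c::comm_ring_1) = {}"
  using indets_const[of "numeral k :: 'c"] by (simp add: const_def)

lemma finite_indets [simp]: "finite (indets p)"
  by (simp add: indets_def)

lemma indets_addI:
  "indets p \<subseteq> B \<Longrightarrow> indets q \<subseteq> B \<Longrightarrow> indets (p + q) \<subseteq> B"
  using indets_add[of p q] by blast

lemma indets_diffI:
  fixes p q :: "('i \<Rightarrow>\<^sub>0 nat) \<Rightarrow>\<^sub>0 'c::ab_group_add"
  shows "indets p \<subseteq> B \<Longrightarrow> indets q \<subseteq> B \<Longrightarrow> indets (p - q) \<subseteq> B"
  using indets_diff[of p q] by blast

lemma indets_multI: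
  fixes p q :: "('i \<Rightarrow>\<^sub>0 nat) \<Rightarrow>\<^sub>0 'c::comm_ring_1"
  shows "indets p \<subseteq> B \<Longrightarrow> indets q \<subseteq> B \<Longrightarrow> indets (p * q) \<subseteq> B"
  using indets_mult[of p q] by blast

lemma indets_powerI:
  fixes p :: "('i \<Rightarrow>\<^sub>0 nat) \<Rightarrow>\<^sub>0 'c::comm_ring_1"
  shows "indets p \<subseteq> B \<Longrightarrow> indets (p ^ k) \<subseteq> B"
  by (induction k) (simp_all add: indets_multI)

lemma indets_sumI:
  "(\<And>a. a \<in> A \<Longrightarrow> indets (g a) \<subseteq> B) \<Longrightarrow> indets (sum g A) \<subseteq> B"
  by (induction A rule: infinite_finite_induct) (simp_all add: indets_addI)

lemma indets_prodI:
  fixes g :: "_ \<Rightarrow> ('i \<Rightarrow>\<^sub>0 nat) \<Rightarrow>\<^sub>0 'c::comm_ring_1"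
  shows "(\<And>a. a \<in> A \<Longrightarrow> indets (g a) \<subseteq> B) \<Longrightarrow> indets (prod g A) \<subseteq> B"
  by (induction A rule: infinite_finite_induct) (simp_all add: indets_multI)

text \<open>This is the coefficient of the \<open>k\<close>-th power of the variable
  \<open>i\<close>, a polynomial in the remaining variables. It allows induction on the number of
  variables.\<close>

definition coeff_in :: "'i \<Rightarrow> nat \<Rightarrow> (('i \<Rightarrow>\<^sub>0 nat) \<Rightarrow>\<^sub>0 'c::comm_ring_1) \<Rightarrow> ('i \<Rightarrow>\<^sub>0 nat) \<Rightarrow>\<^sub>0 'c"
  where "coeff_in i k p =
    (\<Sum>m\<in>{m\<in>Poly_Mapping.keys p. Poly_Mapping.lookup m i = k}.
       Poly_Mapping.single (m - Poly_Mapping.single i k) (Poly_Mapping.lookup p m))"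

lemma minus_single_add:
  "Poly_Mapping.lookup m i = k \<Longrightarrow> m - Poly_Mapping.single i k + Poly_Mapping.single i k = (m :: 'i \<Rightarrow>\<^sub>0 nat)"
  by (rule poly_mapping_eqI) (auto simp: lookup_add lookup_minus lookup_single when_def)

lemma coeff_in_expansion:
  fixes p :: "('i \<Rightarrow>\<^sub>0 nat) \<Rightarrow>\<^sub>0 'c::comm_ring_1"
  assumes "\<And>m. m \<in> Poly_Mapping.keys p \<Longrightarrow> Poly_Mapping.lookup m i \<le> d"
  shows "p = (\<Sum>k\<le>d. coeff_in i k p * var i ^ k)"
proof -
  have pw: "(var i :: ('i \<Rightarrow>\<^sub>0 nat) \<Rightarrow>\<^sub>0 'c) ^ k = Poly_Mapping.single (Poly_Mapping.single i k) 1" for k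
    by (induction k) (auto simp: var_def mult_single simp flip: single_add)
  have "(\<Sum>k\<le>d. coeff_in i k p * var i ^ k) =
     (\<Sum>k\<le>d. \<Sum>m\<in>{m\<in>Poly_Mapping.keys p. Poly_Mapping.lookup m i = k}.
        Poly_Mapping.single m (Poly_Mapping.lookup p m))"
    unfolding coeff_in_def pw sum_distrib_right mult_single
    by (intro sum.cong refl) (auto simp: minus_single_add)
  also have "\<dots> = (\<Sum>m\<in>Poly_Mapping.keys p. Poly_Mapping.single m (Poly_Mapping.lookup p m))"
    by (rule sum.group) (use assms in auto)
  finally show ?thesis using poly_mapping_sum_singles[of p] by simp
qed

lemma indets_coeff_in: "indets (coeff_in i k p) \<subseteq> indets p - {i}"
proof -
  have "indets (coeff_in i k p) \<subseteq> {j. j \<noteq> i \<and> j \<in> indets p}"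
    unfolding coeff_in_def
    by (intro indets_sumI)
      (auto simp: indets_def in_keys_iff lookup_minus lookup_single when_def split: if_splits)
  then show ?thesis by auto
qed

lemma coeff_in_nonzero:
  assumes "p \<noteq> 0" obtains k where "coeff_in i k p \<noteq> 0"
proof -
  let ?d = "Max ((\<lambda>m. Poly_Mapping.lookup m i) ` Poly_Mapping.keys p)"
  have "p = (\<Sum>k\<le>?d. coeff_in i k p * var i ^ k)"
    by (rule coeff_in_expansion) auto
  with assms that show ?thesis
    by (metis (no_types, lifting) mult_zero_left sum.neutral)
qed

text \<open>Substituting for all variables but \<open>i\<close> leaves a univariate polynomial over
  the target ring. The \<open>insert 0\<close> keeps the maximum defined for
  \<open>p = 0\<close>.\<close>

definition insertion_poly :: "'i \<Rightarrow> ('c::comm_ring_1 \<Rightarrow> 'b::comm_ring_1) \<Rightarrow> ('i \<Rightarrow> 'b) \<Rightarrow> (('i \<Rightarrow>\<^sub>0 nat) \<Rightarrow>\<^sub>0 'c) \<Rightarrow> 'b poly"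
  where "insertion_poly i h f p =
    (\<Sum>k\<le>Max (insert 0 ((\<lambda>m. Poly_Mapping.lookup m i) ` Poly_Mapping.keys p)). monom (insertion h f (coeff_in i k p)) k)"

lemma coeff_in_eq_0:
  assumes "Max (insert 0 ((\<lambda>m. Poly_Mapping.lookup m i) ` Poly_Mapping.keys p)) < k"
  shows "coeff_in i k p = 0"
proof -
  have "{m\<in>Poly_Mapping.keys p. Poly_Mapping.lookup m i = k} = {}"
    using assms by auto
  then show ?thesis unfolding coeff_in_def by (simp only: sum.empty)
qed

lemma coeff_insertion_poly:
  assumes "h 0 = 0"
  shows "coeff (insertion_poly i h f p) k = insertion h f (coeff_in i k p)"
proof -
  have [simp]: "insertion h f 0 = 0" by (simp add: insertion_def)
  show ?thesis
    by (auto simp: insertion_poly_def coeff_sum coeff_in_eq_0 not_le)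
qed

lemma (in coeff_hom) poly_insertion_poly:
  "poly (insertion_poly i h f p) (f i) = insertion h f p"
proof -
  let ?d = "Max (insert 0 ((\<lambda>m. Poly_Mapping.lookup m i) ` Poly_Mapping.keys p))"
  have "p = (\<Sum>k\<le>?d. coeff_in i k p * var i ^ k)"
    by (rule coeff_in_expansion) auto
  then have "insertion h f p = insertion h f (\<Sum>k\<le>?d. coeff_in i k p * var i ^ k)"
    by simp
  also have "\<dots> = poly (insertion_poly i h f p) (f i)"
    by (simp add: insertion_poly_def poly_sum poly_monom)
  finally show ?thesis by simp
qed

section \<open>Fields as rings with carrier\<close>

lemma ring_of_type_algebra_simps [simp]:
  "carrier (ring_of_type_algebra :: 'a::field ring) = UNIV"
  "x \<otimes>\<^bsub>(ring_of_type_algebra :: 'a ring)\<^esub> y = x * y"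
  "x \<oplus>\<^bsub>(ring_of_type_algebra :: 'a ring)\<^esub> y = x + y"
  "\<zero>\<^bsub>(ring_of_type_algebra :: 'a ring)\<^esub> = 0"
  "\<one>\<^bsub>(ring_of_type_algebra :: 'a ring)\<^esub> = 1"
  by (simp_all add: ring_of_type_algebra_def)

context
begin

interpretation type_field: field "ring_of_type_algebra :: 'a::field ring"
  by (rule field_from_type_algebra)

lemma a_inv_ring_of_type_algebra [simp]:
  "\<ominus>\<^bsub>(ring_of_type_algebra :: 'a::field ring)\<^esub> x = - x"
  using type_field.minus_equality[of "-x" x] by simp

lemma m_inv_ring_of_type_algebra [simp]:
  "x \<noteq> 0 \<Longrightarrow> inv\<^bsub>(ring_of_type_algebra :: 'a::field ring)\<^esub> x = inverse x"
  by (rule type_field.comm_inv_char) auto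

lemma pow_ring_of_type_algebra [simp]:
  "x [^]\<^bsub>(ring_of_type_algebra :: 'a::field ring)\<^esub> (k::nat) = x ^ k"
  by (induction k) (simp_all add: mult.commute)

lemma subfield_ring_of_type_algebraI:
  fixes K :: "'a::field set"
  assumes "1 \<in> K" "\<And>x. x \<in> K \<Longrightarrow> - x \<in> K" "\<And>x y. x \<in> K \<Longrightarrow> y \<in> K \<Longrightarrow> x + y \<in> K"
    "\<And>x y. x \<in> K \<Longrightarrow> y \<in> K \<Longrightarrow> x * y \<in> K" "\<And>x. x \<in> K \<Longrightarrow> x \<noteq> 0 \<Longrightarrow> inverse x \<in> K"
  shows "subfield K ring_of_type_algebra"
  using assms by (intro type_field.subfieldI' type_field.subringI) auto

lemma subfield_ring_of_type_algebraD:
  fixes K :: "'a::field set"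
  assumes "subfield K ring_of_type_algebra"
  shows "0 \<in> K" "1 \<in> K" "x \<in> K \<Longrightarrow> - x \<in> K" "x \<in> K \<Longrightarrow> y \<in> K \<Longrightarrow> x + y \<in> K"
    "x \<in> K \<Longrightarrow> y \<in> K \<Longrightarrow> x * y \<in> K" "x \<in> K \<Longrightarrow> inverse x \<in> K" "x \<in> K \<Longrightarrow> y \<in> K \<Longrightarrow> x / y \<in> K"
    "x \<in> K \<Longrightarrow> y \<in> K \<Longrightarrow> x - y \<in> K"
proof -
  note sr = subfieldE(1)[OF assms]
  show 0: "0 \<in> K" and "1 \<in> K" using subringE(2,3)[OF sr] by auto
  show m: "x * y \<in> K" if "x \<in> K" "y \<in> K" for x y using subringE(6)[OF sr that] by simp
  show a: "x + y \<in> K" if "x \<in> K" "y \<in> K" for x y using subringE(7)[OF sr that] by simp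
  show u: "- x \<in> K" if "x \<in> K" for x using subringE(5)[OF sr that] by simp
  show i: "inverse x \<in> K" if "x \<in> K" for x
    using type_field.subfield_m_inv(1)[OF assms, of x] that 0 by (cases "x = 0") auto
  show "x / y \<in> K" if "x \<in> K" "y \<in> K" for x y using m[OF that(1) i[OF that(2)]] by (simp add: divide_inverse)
  show "x - y \<in> K" if "x \<in> K" "y \<in> K" for x y using a[OF that(1) u[OF that(2)]] by simp
qed

text \<open>Coefficient lists in HOL-Algebra begin with the leading coefficient, those of
  \<open>Poly\<close> with the constant one; hence the reversal.\<close>

lemma eval_ring_of_type_algebra:
  "ring.eval (ring_of_type_algebra :: 'a::field ring) xs x = poly (Poly (rev xs)) x"
  by (induction xs) (simp_all add: type_field.eval.simps Poly_append poly_monom algebra_simps)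

text \<open>This is a bridge to HOL-Algebra, whose theorem that the algebraic elements form a
  subfield is wanted for polynomials of type \<open>'a poly\<close>.\<close>

lemma algebraic_over_iff:
  fixes K :: "'a::field set"
  assumes "subfield K ring_of_type_algebra"
  shows "(ring.algebraic ring_of_type_algebra over K) x \<longleftrightarrow>
    (\<exists>p. p \<noteq> 0 \<and> (\<forall>i. coeff p i \<in> K) \<and> poly p x = 0)"
proof
  note sr = subfieldE(1)[OF assms]
  assume "(ring.algebraic ring_of_type_algebra over K) x"
  then obtain xs where xs: "xs \<in> carrier (univ_poly ring_of_type_algebra K)" "xs \<noteq> []"
      "ring.eval ring_of_type_algebra xs x = \<zero>\<^bsub>(ring_of_type_algebra :: 'a ring)\<^esub>"
    using type_field.algebraicE[OF sr, of x] by auto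
  have poly: "set xs \<subseteq> K" "hd xs \<noteq> 0"
    using xs(1,2) by (auto simp: univ_poly_def polynomial_def)
  have "coeff (Poly (rev xs)) (length xs - 1) \<noteq> 0"
    using poly(2) xs(2) by (simp add: nth_default_def rev_nth hd_conv_nth)
  then have "Poly (rev xs) \<noteq> 0" by force
  moreover have "coeff (Poly (rev xs)) i \<in> K" for i
    using poly(1) subfield_ring_of_type_algebraD(1)[OF assms]
    by (auto simp: nth_default_def rev_nth)
  moreover have "poly (Poly (rev xs)) x = 0"
    using xs(3) by (simp add: eval_ring_of_type_algebra)
  ultimately show "\<exists>p. p \<noteq> 0 \<and> (\<forall>i. coeff p i \<in> K) \<and> poly p x = 0" by blast
next
  assume "\<exists>p. p \<noteq> 0 \<and> (\<forall>i. coeff p i \<in> K) \<and> poly p x = 0"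
  then obtain p where p: "p \<noteq> 0" "\<And>i. coeff p i \<in> K" "poly p x = 0" by blast
  show "(ring.algebraic ring_of_type_algebra over K) x"
  proof (rule type_field.algebraicI)
    show "rev (coeffs p) \<in> carrier (univ_poly ring_of_type_algebra K)"
      using p(1,2) by (auto simp: univ_poly_def polynomial_def hd_rev last_coeffs_eq_coeff_degree coeffs_def)
    show "rev (coeffs p) \<noteq> []" using p(1) by simp
    show "ring.eval ring_of_type_algebra (rev (coeffs p)) x = \<zero>\<^bsub>(ring_of_type_algebra :: 'a ring)\<^esub>"
      using p(3) by (simp add: eval_ring_of_type_algebra)
  qed
qed

text \<open>The elements algebraic over \<open>K\<close> form a subfield. The case
  \<open>c = 0\<close> is covered, since then \<open>a / c = 0\<close>.\<close>

lemma algebraic_quotient: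
  fixes K :: "'a::field set"
  assumes K: "subfield K ring_of_type_algebra"
    and "p \<noteq> 0" "\<And>i. coeff p i \<in> K" "poly p a = 0"
    and "q \<noteq> 0" "\<And>i. coeff q i \<in> K" "poly q c = 0"
  obtains r where "r \<noteq> 0" "\<And>i. coeff r i \<in> K" "poly r (a / c) = 0"
proof -
  have "a / c \<in> {x \<in> carrier ring_of_type_algebra. (ring.algebraic ring_of_type_algebra over K) x}"
    by (rule subfield_ring_of_type_algebraD(7)[OF type_field.subfield_of_algebraics[OF K]])
      (use assms in \<open>auto simp: algebraic_over_iff[OF K]\<close>)
  with that show ?thesis by (auto simp: algebraic_over_iff[OF K])
qed

subsection \<open>Algebraic independence over the rationals\<close>

text \<open>As \<open>of_rat\<close> is injective, a polynomial whose coefficients are rational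
  elements of the field can be exchanged for one over the type \<open>rat\<close>, and back.\<close>

lemma alg_independent_Rats_iff:
  fixes B :: "'a::field_char_0 set"
  shows "alg_independent \<rat> B \<longleftrightarrow>
    (\<forall>p :: ('a \<Rightarrow>\<^sub>0 nat) \<Rightarrow>\<^sub>0 rat. indets p \<subseteq> B \<longrightarrow> insertion of_rat (\<lambda>b. b) p = 0 \<longrightarrow> p = 0)"
    (is "_ \<longleftrightarrow> ?rhs")
proof
  assume indep: "alg_independent \<rat> B"
  show ?rhs
  proof (intro allI impI)
    fix p :: "('a \<Rightarrow>\<^sub>0 nat) \<Rightarrow>\<^sub>0 rat"
    assume p: "indets p \<subseteq> B" "insertion of_rat (\<lambda>b. b) p = (0::'a)"
    define q :: "('a \<Rightarrow>\<^sub>0 nat) \<Rightarrow>\<^sub>0 'a" where "q = Poly_Mapping.map of_rat p"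
    have lq: "Poly_Mapping.lookup q m = of_rat (Poly_Mapping.lookup p m)" for m
      by (simp add: q_def map.rep_eq when_def)
    then have kq: "Poly_Mapping.keys q = Poly_Mapping.keys p"
      by (auto simp: in_keys_iff)
    have "Poly_Mapping.range q \<subseteq> \<rat>"
      by (auto simp: range.rep_eq lq Rats_def)
    moreover have "indets q \<subseteq> B" using p(1) by (simp add: indets_def kq)
    moreover have "poly_eval (\<lambda>b. b) q = 0"
      using p(2) by (simp add: poly_eval_def insertion_def monomial_eval_def kq lq)
    ultimately have "q = 0" using indep by (auto simp: alg_independent_def)
    then show "p = 0" using kq by (metis keys_eq_empty keys_zero)
  qed
next
  assume rhs: ?rhs
  show "alg_independent \<rat> B" unfolding alg_independent_def
  proof (intro allI impI)
    fix q :: "('a \<Rightarrow>\<^sub>0 nat) \<Rightarrow>\<^sub>0 'a"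
    assume q: "Poly_Mapping.range q \<subseteq> \<rat>" "indets q \<subseteq> B" "poly_eval (\<lambda>b. b) q = 0"
    define p where "p = Poly_Mapping.map (inv_into UNIV of_rat :: 'a \<Rightarrow> rat) q"
    have inv0: "inv_into UNIV of_rat (0::'a) = (0::rat)"
      by (rule inv_f_eq) (auto simp: inj_def)
    have lp: "of_rat (Poly_Mapping.lookup p m) = Poly_Mapping.lookup q m" for m
    proof -
      have "Poly_Mapping.lookup q m \<in> \<rat>"
        using q(1) by (cases "Poly_Mapping.lookup q m = 0") (auto simp: range.rep_eq)
      then show ?thesis
        using inv0 by (auto simp: p_def map.rep_eq when_def Rats_def f_inv_into_f)
    qed
    have kp: "Poly_Mapping.keys p = Poly_Mapping.keys q"
      by (auto simp: in_keys_iff simp flip: lp)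
    have "indets p \<subseteq> B" using q(2) by (simp add: indets_def kp)
    moreover have "insertion of_rat (\<lambda>b. b) p = (0::'a)"
      using q(3) by (simp add: poly_eval_def insertion_def monomial_eval_def kp lp)
    ultimately have "p = 0" using rhs by blast
    then show "q = 0" using kp by (metis keys_eq_empty keys_zero)
  qed
qed

lemma alg_independent_subset:
  "alg_independent K B \<Longrightarrow> C \<subseteq> B \<Longrightarrow> alg_independent K C"
  unfolding alg_independent_def by blast

text \<open>The quotients of values of rational polynomials at \<open>B\<close> are closed under the
  field operations, by the usual rules for fractions.\<close>

lemma generate_field_Rats_cases:
  fixes B :: "'a::field_char_0 set"
  assumes "x \<in> generate_field ring_of_type_algebra (\<rat> \<union> B)"
  obtains p q :: "('a \<Rightarrow>\<^sub>0 nat) \<Rightarrow>\<^sub>0 rat" where "indets p \<subseteq> B" "indets q \<subseteq> B"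
    "insertion of_rat (\<lambda>b. b) q \<noteq> (0::'a)"
    "x = insertion of_rat (\<lambda>b. b) p / insertion of_rat (\<lambda>b. b) q"
proof -
  have "\<exists>p q :: ('a \<Rightarrow>\<^sub>0 nat) \<Rightarrow>\<^sub>0 rat. indets p \<subseteq> B \<and> indets q \<subseteq> B \<and>
    insertion of_rat (\<lambda>b. b) q \<noteq> (0::'a) \<and>
    x = insertion of_rat (\<lambda>b. b) p / insertion of_rat (\<lambda>b. b) q"
    using assms
  proof induction
    case one
    show ?case by (rule exI[of _ 1], rule exI[of _ 1]) simp
  next
    case (incl x)
    then consider r where "x = of_rat r" | "x \<in> B" by (auto elim: Rats_cases)
    then show ?case
    proof cases
      case 1
      then show ?thesis by (intro exI[of _ "const r"] exI[of _ 1]) simp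
    next
      case 2
      then show ?thesis by (intro exI[of _ "var x"] exI[of _ 1]) simp
    qed
  next
    case (a_inv x)
    then obtain p q :: "('a \<Rightarrow>\<^sub>0 nat) \<Rightarrow>\<^sub>0 rat" where "indets p \<subseteq> B" "indets q \<subseteq> B"
      "insertion of_rat (\<lambda>b. b) q \<noteq> (0::'a)"
      "x = insertion of_rat (\<lambda>b. b) p / insertion of_rat (\<lambda>b. b) q" by blast
    then show ?case by (intro exI[of _ "- p"] exI[of _ q]) simp
  next
    case (m_inv x)
    then obtain p q :: "('a \<Rightarrow>\<^sub>0 nat) \<Rightarrow>\<^sub>0 rat" where "indets p \<subseteq> B" "indets q \<subseteq> B"
      "insertion of_rat (\<lambda>b. b) q \<noteq> (0::'a)"
      "x = insertion of_rat (\<lambda>b. b) p / insertion of_rat (\<lambda>b. b) q" by blast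
    with m_inv.hyps show ?case by (intro exI[of _ q] exI[of _ p]) auto
  next
    case (eng_add x y)
    then obtain p q p' q' :: "('a \<Rightarrow>\<^sub>0 nat) \<Rightarrow>\<^sub>0 rat" where "indets p \<subseteq> B" "indets q \<subseteq> B"
      "insertion of_rat (\<lambda>b. b) q \<noteq> (0::'a)"
      "x = insertion of_rat (\<lambda>b. b) p / insertion of_rat (\<lambda>b. b) q"
      "indets p' \<subseteq> B" "indets q' \<subseteq> B"
      "insertion of_rat (\<lambda>b. b) q' \<noteq> (0::'a)"
      "y = insertion of_rat (\<lambda>b. b) p' / insertion of_rat (\<lambda>b. b) q'" by metis
    then show ?case
      by (intro exI[of _ "p * q' + p' * q"] exI[of _ "q * q'"])
        (simp add: indets_multI indets_addI add_frac_eq)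
  next
    case (eng_mult x y)
    then obtain p q p' q' :: "('a \<Rightarrow>\<^sub>0 nat) \<Rightarrow>\<^sub>0 rat" where "indets p \<subseteq> B" "indets q \<subseteq> B"
      "insertion of_rat (\<lambda>b. b) q \<noteq> (0::'a)"
      "x = insertion of_rat (\<lambda>b. b) p / insertion of_rat (\<lambda>b. b) q"
      "indets p' \<subseteq> B" "indets q' \<subseteq> B"
      "insertion of_rat (\<lambda>b. b) q' \<noteq> (0::'a)"
      "y = insertion of_rat (\<lambda>b. b) p' / insertion of_rat (\<lambda>b. b) q'" by metis
    then show ?case
      by (intro exI[of _ "p * p'"] exI[of _ "q * q'"]) (simp add: indets_multI)
  qed
  with that show ?thesis by blast
qed

lemma generate_field_subfield:
  "subfield (generate_field ring_of_type_algebra H) (ring_of_type_algebra :: 'a::field ring)"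
  by (rule type_field.generate_field_is_subfield) simp

lemma insertion_in_subfield:
  fixes K :: "'a::field_char_0 set"
  assumes K: "subfield K ring_of_type_algebra" and "\<rat> \<subseteq> K" "\<And>i. i \<in> indets p \<Longrightarrow> f i \<in> K"
  shows "insertion of_rat f p \<in> K"
proof -
  note D = subfield_ring_of_type_algebraD[OF K]
  have pow: "x ^ k \<in> K" if "x \<in> K" for x and k :: nat
    by (induction k) (use that D in auto)
  have prod: "prod g A \<in> K" if "\<And>a. a \<in> A \<Longrightarrow> g a \<in> K" for g and A :: "'b set"
    using that by (induction A rule: infinite_finite_induct) (use D in auto)
  have sum: "sum g A \<in> K" if "\<And>a. a \<in> A \<Longrightarrow> g a \<in> K" for g and A :: "('b \<Rightarrow>\<^sub>0 nat) set"
    using that by (induction A rule: infinite_finite_induct) (use D in auto)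
  show ?thesis unfolding insertion_def monomial_eval_def
    by (intro sum D(5) prod pow) (use assms(2,3) in \<open>auto simp: indets_def\<close>)
qed


text \<open>A relation among \<open>x\<close> and \<open>B\<close>, sorted by powers of
  \<open>x\<close>, is a univariate polynomial over the field generated by \<open>B\<close> with
  root \<open>x\<close>. So its coefficients vanish, and independence of \<open>B\<close> makes each
  of them the zero polynomial.\<close>

lemma alg_independent_insertI:
  fixes B :: "'a::field_char_0 set"
  assumes B: "alg_independent \<rat> B"
    and x: "\<And>q. (\<And>i. coeff q i \<in> generate_field ring_of_type_algebra (\<rat> \<union> B)) \<Longrightarrow> poly q x = 0 \<Longrightarrow> q = 0"
  shows "alg_independent \<rat> (insert x B)"
  unfolding alg_independent_Rats_iff
proof (intro allI impI)
  fix p :: "('a \<Rightarrow>\<^sub>0 nat) \<Rightarrow>\<^sub>0 rat"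
  assume p: "indets p \<subseteq> insert x B" "insertion of_rat (\<lambda>b. b) p = (0::'a)"
  have ind: "indets (coeff_in x k p) \<subseteq> B" for k
    using indets_coeff_in[of x k p] p(1) by auto
  have "insertion_poly x (of_rat :: _ \<Rightarrow> 'a) (\<lambda>b. b) p = 0"
  proof (rule x)
    show "coeff (insertion_poly x (of_rat :: _ \<Rightarrow> 'a) (\<lambda>b. b) p) i
        \<in> generate_field ring_of_type_algebra (\<rat> \<union> B)" for i
      unfolding coeff_insertion_poly[of of_rat, OF of_rat_0]
      by (rule insertion_in_subfield[OF generate_field_subfield])
        (use ind[of i] in \<open>auto intro: generate_field.incl\<close>)
    show "poly (insertion_poly x (of_rat :: _ \<Rightarrow> 'a) (\<lambda>b. b) p) x = 0"
      using of_rat.poly_insertion_poly[of x "\<lambda>b::'a. b" p] p(2) by simp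
  qed
  then have "insertion of_rat (\<lambda>b. b) (coeff_in x k p) = (0::'a)" for k
    by (simp add: coeff_insertion_poly[symmetric])
  then have "coeff_in x k p = 0" for k
    using B ind unfolding alg_independent_Rats_iff by blast
  then show "p = 0" using coeff_in_nonzero by metis
qed

text \<open>Clearing denominators turns \<open>q\<close> into a polynomial relation between
  \<open>x\<close> and \<open>B\<close>.\<close>

lemma alg_independent_insertD:
  fixes B :: "'a::field_char_0 set"
  assumes ind: "alg_independent \<rat> (insert x B)" and "x \<notin> B"
    and q: "\<And>i. coeff q i \<in> generate_field ring_of_type_algebra (\<rat> \<union> B)" "poly q x = 0"
  shows "q = 0"
proof -
  let ?ev = "insertion of_rat (\<lambda>b. b) :: (('a \<Rightarrow>\<^sub>0 nat) \<Rightarrow>\<^sub>0 rat) \<Rightarrow> 'a"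
  have "\<forall>i. \<exists>a b :: ('a \<Rightarrow>\<^sub>0 nat) \<Rightarrow>\<^sub>0 rat. indets a \<subseteq> B \<and> indets b \<subseteq> B \<and> ?ev b \<noteq> 0 \<and> coeff q i = ?ev a / ?ev b"
  proof
    fix i
    show "\<exists>a b :: ('a \<Rightarrow>\<^sub>0 nat) \<Rightarrow>\<^sub>0 rat. indets a \<subseteq> B \<and> indets b \<subseteq> B \<and> ?ev b \<noteq> 0 \<and> coeff q i = ?ev a / ?ev b"
      by (rule generate_field_Rats_cases[OF q(1)[of i]]) blast
  qed
  then obtain a b :: "nat \<Rightarrow> ('a \<Rightarrow>\<^sub>0 nat) \<Rightarrow>\<^sub>0 rat" where
    ab: "\<And>i. indets (a i) \<subseteq> B" "\<And>i. indets (b i) \<subseteq> B" "\<And>i. ?ev (b i) \<noteq> 0"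
      "\<And>i. coeff q i = ?ev (a i) / ?ev (b i)" by metis
  define d where "d = degree q"
  \<comment> \<open>The numerator of \<open>coeff q i\<close> over the common denominator
    \<open>Q\<close>.\<close>
  define c where "c i = a i * (\<Prod>j\<in>{..d} - {i}. b j)" for i
  define P where "P = (\<Sum>i\<le>d. c i * var x ^ i)"
  define Q where "Q = (\<Prod>j\<le>d. b j)"
  have Q: "?ev Q \<noteq> 0" by (simp add: Q_def ab(3))
  have c: "?ev (c i) = ?ev Q * coeff q i" if "i \<le> d" for i
  proof -
    have "Q = b i * (\<Prod>j\<in>{..d} - {i}. b j)"
      unfolding Q_def using that by (subst prod.remove[of _ i]) auto
    then show ?thesis by (simp add: c_def ab)
  qed
  have ic: "indets (c i) \<subseteq> B" for i
    unfolding c_def by (intro indets_multI indets_prodI ab)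
  \<comment> \<open>Since \<open>x\<close> is not in \<open>B\<close>, the value substituted for
    \<open>x\<close> is free: once \<open>P = 0\<close>, the polynomial \<open>q\<close> vanishes at
    every point of an infinite field.\<close>
  have ev: "insertion of_rat (\<lambda>b. if b = x then y else b) P = ?ev Q * poly q y" for y
  proof -
    have "insertion of_rat (\<lambda>b. if b = x then y else b) (c i) = ?ev (c i)" for i
      using ic[of i] \<open>x \<notin> B\<close> by (intro insertion_cong) auto
    then have "insertion of_rat (\<lambda>b. if b = x then y else b) P = (\<Sum>i\<le>d. ?ev (c i) * y ^ i)"
      by (simp add: P_def)
    also have "\<dots> = (\<Sum>i\<le>d. ?ev Q * (coeff q i * y ^ i))"
      by (intro sum.cong) (simp_all add: c)
    also have "\<dots> = ?ev Q * poly q y"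
      by (simp only: poly_altdef d_def sum_distrib_left)
    finally show ?thesis .
  qed
  have "?ev P = insertion of_rat (\<lambda>b. if b = x then x else b) P"
    by (intro insertion_cong) auto
  also have "\<dots> = 0" unfolding ev q(2) by simp
  finally have "?ev P = 0" .
  moreover have "indets P \<subseteq> insert x B"
    unfolding P_def using ic by (intro indets_sumI indets_multI indets_powerI) auto
  ultimately have "P = 0" using ind unfolding alg_independent_Rats_iff by blast
  then have "poly q y = 0" for y using ev[of y] Q by simp
  then show "q = 0" using poly_all_0_iff_0[of q] by blast
qed

text \<open>If \<open>a\<close> and \<open>c\<close> were both algebraic over the field generated by
  \<open>B\<close>, so would be their quotient. One of them is therefore transcendental and can take
  the place of \<open>a / c\<close>.\<close>

lemma alg_independent_exchange:
  fixes B :: "'a::field_char_0 set"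
  assumes "alg_independent \<rat> (insert (a / c) B)" "a / c \<notin> B"
  obtains d where "d \<in> {a, c}" "d \<notin> B" "alg_independent \<rat> (insert d B)"
proof -
  let ?F = "generate_field ring_of_type_algebra (\<rat> \<union> B) :: 'a set"
  note D = subfield_ring_of_type_algebraD[OF generate_field_subfield[of "\<rat> \<union> B"]]
  have B: "alg_independent \<rat> B" by (rule alg_independent_subset[OF assms(1)]) auto
  have "\<exists>d\<in>{a, c}. \<forall>q. (\<forall>i. coeff q i \<in> ?F) \<longrightarrow> poly q d = 0 \<longrightarrow> q = 0"
  proof (rule ccontr)
    assume "\<not> ?thesis"
    then obtain p q where "p \<noteq> 0" "\<And>i. coeff p i \<in> ?F" "poly p a = 0"
      "q \<noteq> 0" "\<And>i. coeff q i \<in> ?F" "poly q c = 0" by blast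
    then obtain r where "r \<noteq> 0" "\<And>i. coeff r i \<in> ?F" "poly r (a / c) = 0"
      by (rule algebraic_quotient[OF generate_field_subfield]) blast
    then show False using alg_independent_insertD[OF assms, of r] by blast
  qed
  then obtain d where d: "d \<in> {a, c}"
    and tr: "\<And>q. (\<And>i. coeff q i \<in> ?F) \<Longrightarrow> poly q d = 0 \<Longrightarrow> q = 0" by blast
  have "d \<notin> B"
  proof
    assume "d \<in> B"
    then have "d \<in> ?F" by (auto intro: generate_field.incl)
    \<comment> \<open>An element of \<open>B\<close> is a root of this linear polynomial over the
      generated field.\<close>
    then have "[:- d, 1:] = 0"
      by (intro tr) (auto simp: coeff_pCons D split: nat.splits)
    then show False by simp
  qed
  show ?thesis
    by (rule that[OF d \<open>d \<notin> B\<close> alg_independent_insertI[OF B tr]])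
qed

section \<open>Transcendence degree of quotients\<close>

lemma trdeg_mono: "A \<subseteq> B \<Longrightarrow> trdeg K A \<le> trdeg K B"
  unfolding trdeg_def by (intro Sup_subset_mono) blast

lemma trdeg_quotients:
  fixes A :: "'a::field_char_0 set"
  assumes quot: "\<And>x. x \<in> L \<Longrightarrow> \<exists>a\<in>A. \<exists>c\<in>A. x = a / c"
  shows "trdeg \<rat> L \<le> trdeg \<rat> A"
proof -
  \<comment> \<open>\<open>T\<close> holds the elements already exchanged for numerators or
    denominators in \<open>A\<close>, and \<open>C\<close> those still to be exchanged. Disjointness
    of the two keeps track of the cardinality.\<close>
  have replace: "\<exists>T'. T' \<subseteq> A \<and> finite T' \<and> alg_independent \<rat> T' \<and> card T' = card T + card C"
    if "finite C" "C \<subseteq> L" "finite T" "T \<subseteq> A" "T \<inter> C = {}" "alg_independent \<rat> (T \<union> C)" for T C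
    using that
  proof (induction C arbitrary: T rule: finite_induct)
    case empty
    then show ?case by (intro exI[of _ T]) simp
  next
    case (insert x C)
    have "x \<in> L" using insert.prems(1) by blast
    then obtain a c where ac: "a \<in> A" "c \<in> A" "x = a / c" using quot by blast
    have "insert x (T \<union> C) = T \<union> insert x C" by blast
    then have "alg_independent \<rat> (insert (a / c) (T \<union> C))"
      using insert.prems(5) by (simp only: ac(3))
    moreover have "a / c \<notin> T \<union> C"
      using insert.prems(4) insert.hyps(2) unfolding ac(3) by blast
    ultimately obtain d where d: "d \<in> {a, c}" "d \<notin> T \<union> C" "alg_independent \<rat> (insert d (T \<union> C))"
      by (rule alg_independent_exchange) blast
    have "\<exists>T'. T' \<subseteq> A \<and> finite T' \<and> alg_independent \<rat> T' \<and> card T' = card (insert d T) + card C"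
    proof (rule insert.IH)
      show "C \<subseteq> L" using insert.prems(1) by blast
      show "finite (insert d T)" using insert.prems(2) by simp
      show "insert d T \<subseteq> A" using insert.prems(3) d(1) ac(1,2) by blast
      show "insert d T \<inter> C = {}" using insert.prems(4) d(2) by blast
      show "alg_independent \<rat> (insert d T \<union> C)" using d(3) by simp
    qed
    moreover have "card (insert d T) = Suc (card T)"
      using d(2) insert.prems(2) by simp
    moreover have "card (insert x C) = Suc (card C)"
      using insert.hyps by simp
    ultimately show ?case by simp
  qed
  show ?thesis
    unfolding trdeg_def
  proof (rule Sup_mono)
    fix k assume "k \<in> {enat (card B) |B. B \<subseteq> L \<and> finite B \<and> alg_independent \<rat> B}"
    then obtain C where C: "k = enat (card C)" "C \<subseteq> L" "finite C" "alg_independent \<rat> C" by blast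
    then obtain T where "T \<subseteq> A" "finite T" "alg_independent \<rat> T" "card T = card C"
      using replace[of C "{}"] by auto
    with C(1) show "\<exists>b\<in>{enat (card B) |B. B \<subseteq> A \<and> finite B \<and> alg_independent \<rat> B}. k \<le> b"
      by (intro bexI[of _ k]) (auto intro: exI[of _ T])
  qed
qed

end

section \<open>Roberts' derivation\<close>

text \<open>The derivative is given by its coefficients. Its support is finite because raising the
  exponent of \<open>i\<close> by one is injective on monomials.\<close>

lift_definition partial_deriv :: "'i \<Rightarrow> (('i \<Rightarrow>\<^sub>0 nat) \<Rightarrow>\<^sub>0 'c::comm_ring_1) \<Rightarrow> ('i \<Rightarrow>\<^sub>0 nat) \<Rightarrow>\<^sub>0 'c"
  is "\<lambda>i p m. of_nat (Poly_Mapping.lookup m i + 1) * p (m + Poly_Mapping.single i 1)"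
proof -
  fix i :: 'i and p :: "('i \<Rightarrow>\<^sub>0 nat) \<Rightarrow> 'c"
  assume "finite {m. p m \<noteq> 0}"
  then have "finite ((\<lambda>m. m + Poly_Mapping.single i 1) -` {m. p m \<noteq> 0})"
    by (rule finite_vimageI) (simp add: inj_def)
  then show "finite {m. of_nat (Poly_Mapping.lookup m i + 1) * p (m + Poly_Mapping.single i 1) \<noteq> 0}"
    by (rule rev_finite_subset) auto
qed

lemma partial_deriv_add: "partial_deriv i (p + q) = partial_deriv i p + partial_deriv i q"
  by (rule poly_mapping_eqI) (simp add: partial_deriv.rep_eq lookup_add algebra_simps)

text \<open>Where the subtraction is truncated, the exponent of \<open>i\<close> is 0 and with it
  the coefficient.\<close>

lemma partial_deriv_single:
  "partial_deriv i (Poly_Mapping.single m a) =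
    Poly_Mapping.single (m - Poly_Mapping.single i 1) (of_nat (Poly_Mapping.lookup m i) * a)"
proof (rule poly_mapping_eqI)
  fix m'
  show "Poly_Mapping.lookup (partial_deriv i (Poly_Mapping.single m a)) m' =
    Poly_Mapping.lookup (Poly_Mapping.single (m - Poly_Mapping.single i 1) (of_nat (Poly_Mapping.lookup m i) * a)) m'"
  proof (cases "Poly_Mapping.lookup m i = 0")
    case True
    then have "m \<noteq> m' + Poly_Mapping.single i 1" by (auto simp: lookup_add)
    with True show ?thesis
      by (simp add: partial_deriv.rep_eq lookup_single when_def)
  next
    case False
    have "m = (m - Poly_Mapping.single i 1) + Poly_Mapping.single i 1"
      using False by (intro poly_mapping_eqI) (auto simp: lookup_add lookup_minus lookup_single when_def)
    then have "m = m' + Poly_Mapping.single i 1 \<longleftrightarrow> m - Poly_Mapping.single i 1 = m'"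
      by (metis add_right_cancel)
    then show ?thesis
      by (cases "m = m' + Poly_Mapping.single i 1")
        (simp_all add: partial_deriv.rep_eq lookup_single when_def lookup_add)
  qed
qed

lemma partial_deriv_mult:
  "partial_deriv i (p * q) = partial_deriv i p * q + p * partial_deriv i q"
proof (induction p rule: poly_mapping_additive_induct)
  case (single m a)
  show ?case
  proof (induction q rule: poly_mapping_additive_induct)
    case (single m' b)
    have "(m - Poly_Mapping.single i 1) + m' = m + m' - Poly_Mapping.single i 1" if "Poly_Mapping.lookup m i \<noteq> 0"
      using that by (intro poly_mapping_eqI) (auto simp: lookup_add lookup_minus lookup_single when_def)
    moreover have "m + (m' - Poly_Mapping.single i 1) = m + m' - Poly_Mapping.single i 1" if "Poly_Mapping.lookup m' i \<noteq> 0"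
      using that by (intro poly_mapping_eqI) (auto simp: lookup_add lookup_minus lookup_single when_def)
    ultimately show ?case
      by (cases "Poly_Mapping.lookup m i = 0"; cases "Poly_Mapping.lookup m' i = 0")
        (simp_all add: mult_single partial_deriv_single lookup_add algebra_simps flip: single_add)
  qed (simp add: partial_deriv_add algebra_simps)
qed (simp add: partial_deriv_add algebra_simps)

lemma partial_deriv_var:
  "partial_deriv i (var j :: ('i \<Rightarrow>\<^sub>0 nat) \<Rightarrow>\<^sub>0 'c::comm_ring_1) = (if i = j then 1 else 0)"
  by (simp add: var_def partial_deriv_single lookup_single)

lemma partial_deriv_const [simp]: "partial_deriv i (const a) = 0"
  by (simp add: const_def partial_deriv_single)

type_synonym qpoly = "(nat \<Rightarrow>\<^sub>0 nat) \<Rightarrow>\<^sub>0 rat"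

text \<open>Roberts' derivation; the indices 1 to 7 stand for \<open>x, y, z, s, t, u, v\<close>.\<close>

definition roberts :: "qpoly \<Rightarrow> qpoly"
  where "roberts p = var 1 ^ 3 * partial_deriv 4 p + var 2 ^ 3 * partial_deriv 5 p
    + var 3 ^ 3 * partial_deriv 6 p + (var 1 * var 2 * var 3) ^ 2 * partial_deriv 7 p"

lemma roberts_add: "roberts (p + q) = roberts p + roberts q"
  by (simp add: roberts_def partial_deriv_add algebra_simps)

lemma roberts_mult: "roberts (p * q) = roberts p * q + p * roberts q"
  by (simp add: roberts_def partial_deriv_mult algebra_simps)

lemma roberts_const [simp]: "roberts (const a) = 0"
  by (simp add: roberts_def)

lemma roberts_0 [simp]: "roberts 0 = 0"
  using roberts_const[of 0] by (simp add: const_def)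

lemma roberts_1 [simp]: "roberts 1 = 0"
  using roberts_const[of 1] by (simp add: const_def)

lemma roberts_uminus: "roberts (- p) = - roberts p"
  by (metis add.right_inverse minus_unique roberts_0 roberts_add)

lemma roberts_sum: "roberts (sum g A) = (\<Sum>a\<in>A. roberts (g a))"
  by (induction A rule: infinite_finite_induct) (simp_all add: roberts_add)

lemma roberts_power: "roberts (p ^ k) = of_nat k * p ^ (k - 1) * roberts p"
proof (induction k)
  case (Suc k)
  then show ?case by (cases k) (simp_all add: roberts_mult algebra_simps)
qed simp

lemma roberts_var:
  "roberts (var i) = (if i = 4 then var 1 ^ 3 else if i = 5 then var 2 ^ 3 else if i = 6 then var 3 ^ 3
     else if i = 7 then (var 1 * var 2 * var 3) ^ 2 else 0)"
  by (simp add: roberts_def partial_deriv_var)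

lemma var_power: "var i ^ k = Poly_Mapping.single (Poly_Mapping.single i k) (1 :: 'c::comm_ring_1)"
  by (induction k) (simp_all add: var_def mult_single flip: single_add)

lemma lookup_single_mult_add:
  "Poly_Mapping.lookup (Poly_Mapping.single a c * q) (a + m) = c * Poly_Mapping.lookup q m"
  for q :: "('i \<Rightarrow>\<^sub>0 nat) \<Rightarrow>\<^sub>0 'c::comm_ring_1"
  by (induction q rule: poly_mapping_additive_induct)
    (auto simp: mult_single lookup_single when_def lookup_add distrib_left)

lemma lookup_single_mult_eq_0:
  "(\<And>b. m \<noteq> a + b) \<Longrightarrow> Poly_Mapping.lookup (Poly_Mapping.single a c * q) m = 0"
  for q :: "('i \<Rightarrow>\<^sub>0 nat) \<Rightarrow>\<^sub>0 'c::comm_ring_1"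
  by (induction q rule: poly_mapping_additive_induct)
    (auto simp: mult_single lookup_single when_def lookup_add algebra_simps)

text \<open>A coefficient of a product is a sum over the splittings of its exponent; here it
  vanishes term by term.\<close>

lemma lookup_mult_eq_0I:
  fixes p q :: "('i \<Rightarrow>\<^sub>0 nat) \<Rightarrow>\<^sub>0 'c::comm_ring_1"
  assumes "\<And>a b. m = a + b \<Longrightarrow> Poly_Mapping.lookup p a * Poly_Mapping.lookup q b = 0"
  shows "Poly_Mapping.lookup (p * q) m = 0"
proof -
  have "p * q = (\<Sum>a\<in>Poly_Mapping.keys p. Poly_Mapping.single a (Poly_Mapping.lookup p a) * q)"
    by (subst poly_mapping_sum_singles[of p]) (rule sum_distrib_right)
  moreover have "Poly_Mapping.lookup (Poly_Mapping.single a (Poly_Mapping.lookup p a) * q) m = 0" for a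
  proof (cases "\<exists>b. m = a + b")
    case True
    then show ?thesis using assms by (auto simp: lookup_single_mult_add)
  next
    case False
    then show ?thesis by (intro lookup_single_mult_eq_0) auto
  qed
  ultimately show ?thesis by (simp add: lookup_sum)
qed

text \<open>Of the four summands of \<open>roberts p\<close> only the last one contains monomials \<open>x\<^sup>2 y\<^sup>2 z\<^sup>2 v\<^sup>k\<close>.\<close>

lemma roberts_kernel_coeff:
  assumes "roberts p = 0"
  shows "Poly_Mapping.lookup p (Poly_Mapping.single 7 (Suc k)) = 0"
proof -
  define w :: "nat \<Rightarrow>\<^sub>0 nat"
    where "w = Poly_Mapping.single 1 2 + Poly_Mapping.single 2 2 + Poly_Mapping.single 3 2"
  have w: "(var 1 * var 2 * var 3 :: qpoly) ^ 2 = Poly_Mapping.single w 1"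
    by (simp add: power_mult_distrib var_power w_def mult_single)
  \<comment> \<open>Multiples of the cube of \<open>x\<close>, \<open>y\<close> or \<open>z\<close>
    cannot contain a monomial in which that variable has exponent 2.\<close>
  have z: "Poly_Mapping.lookup (var i ^ 3 * q) (w + Poly_Mapping.single 7 k) = 0"
    if "i \<in> {1, 2, 3}" for i and q :: qpoly
    unfolding var_power
  proof (rule lookup_single_mult_eq_0)
    fix b
    have "Poly_Mapping.lookup (w + Poly_Mapping.single 7 k) i = 2"
      using that by (auto simp: w_def lookup_add lookup_single)
    moreover have "Poly_Mapping.lookup (Poly_Mapping.single i (3::nat) + b) i = 3 + Poly_Mapping.lookup b i"
      by (simp add: lookup_add)
    ultimately show "w + Poly_Mapping.single 7 k \<noteq> Poly_Mapping.single i (3::nat) + b"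
      by (intro notI) simp
  qed
  have "Poly_Mapping.lookup (roberts p) (w + Poly_Mapping.single 7 k) =
      Poly_Mapping.lookup (partial_deriv 7 p) (Poly_Mapping.single 7 k)"
    unfolding roberts_def w lookup_add by (simp add: z lookup_single_mult_add)
  also have "\<dots> = of_nat (Suc k) * Poly_Mapping.lookup p (Poly_Mapping.single 7 (Suc k))"
    by (simp add: partial_deriv.rep_eq flip: single_add)
  finally show ?thesis using assms by simp
qed


subsection \<open>An \<open>\<s>\<l>\<^sub>2\<close> argument on boxes\<close>

text \<open>If \<open>d a b c\<close> are the coefficients of \<open>s^a t^b u^c\<close>, this is
  the sum of the three partial derivatives: the form that Roberts' derivation takes once the powers
  of \<open>x\<close>, \<open>y\<close>, \<open>z\<close> are split off.\<close>

definition lower :: "(nat \<Rightarrow> nat \<Rightarrow> nat \<Rightarrow> rat) \<Rightarrow> nat \<Rightarrow> nat \<Rightarrow> nat \<Rightarrow> rat"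
  where "lower d a b c = of_nat (a + 1) * d (a + 1) b c + of_nat (b + 1) * d a (b + 1) c
    + of_nat (c + 1) * d a b (c + 1)"

text \<open>This is the raising operator on the tensor product of three irreducible representations
  of highest weights \<open>A\<close>, \<open>B\<close>, \<open>C\<close>. The factor
  \<open>A - a'\<close> vanishes at \<open>a' = A\<close>, so the box is not left.\<close>

definition raise :: "nat \<Rightarrow> nat \<Rightarrow> nat \<Rightarrow> (nat \<Rightarrow> nat \<Rightarrow> nat \<Rightarrow> rat) \<Rightarrow> nat \<Rightarrow> nat \<Rightarrow> nat \<Rightarrow> rat"
  where "raise A B C d a b c =
    (case a of 0 \<Rightarrow> 0 | Suc a' \<Rightarrow> (of_nat A - of_nat a') * d a' b c)
    + (case b of 0 \<Rightarrow> 0 | Suc b' \<Rightarrow> (of_nat B - of_nat b') * d a b' c)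
    + (case c of 0 \<Rightarrow> 0 | Suc c' \<Rightarrow> (of_nat C - of_nat c') * d a b c')"

text \<open>The weight is an integer because lowering can make it negative, where only
  \<open>d = 0\<close> is left.\<close>

definition box_weight :: "nat \<Rightarrow> nat \<Rightarrow> nat \<Rightarrow> int \<Rightarrow> (nat \<Rightarrow> nat \<Rightarrow> nat \<Rightarrow> rat) \<Rightarrow> bool"
  where "box_weight A B C w d \<longleftrightarrow>
    (\<forall>a b c. d a b c \<noteq> 0 \<longrightarrow> int (a + b + c) = w \<and> a \<le> A \<and> b \<le> B \<and> c \<le> C)"

text \<open>The commutator relation of \<open>sl_2\<close>: on \<open>s^a\<close> the commutator
  acts by \<open>(a + 1) (A - a) - a (A - a + 1) = A - 2 a\<close>, and the three tensor factors add
  up.\<close>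

lemma lower_raise:
  "lower (raise A B C d) a b c =
    raise A B C (lower d) a b c + (of_nat (A + B + C) - 2 * of_nat (a + b + c)) * d a b c"
  by (cases a; cases b; cases c) (simp_all add: lower_def raise_def algebra_simps)

lemma lower_linear:
  "lower (\<lambda>a b c. s * d a b c + r * e a b c) a b c = s * lower d a b c + r * lower e a b c"
  by (simp add: lower_def algebra_simps)

lemma lower_add: "lower (\<lambda>a b c. d a b c + r * e a b c) = (\<lambda>a b c. lower d a b c + r * lower e a b c)"
  by (intro ext) (simp add: lower_def algebra_simps)

lemma lower_pow_add:
  "(lower ^^ k) (\<lambda>a b c. d a b c + r * e a b c) = (\<lambda>a b c. (lower ^^ k) d a b c + r * (lower ^^ k) e a b c)"
  by (induction k) (simp_all add: lower_add)

lemma box_weightD: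
  "box_weight A B C w d \<Longrightarrow> d a b c \<noteq> 0 \<Longrightarrow> int (a + b + c) = w \<and> a \<le> A \<and> b \<le> B \<and> c \<le> C"
  by (simp add: box_weight_def)

lemma box_weight_lower:
  assumes "box_weight A B C w d"
  shows "box_weight A B C (w - 1) (lower d)"
  unfolding box_weight_def
proof (intro allI impI)
  fix a b c assume "lower d a b c \<noteq> 0"
  then consider "d (a + 1) b c \<noteq> 0" | "d a (b + 1) c \<noteq> 0" | "d a b (c + 1) \<noteq> 0"
    by (cases "d (a + 1) b c = 0"; cases "d a (b + 1) c = 0") (auto simp: lower_def)
  then show "int (a + b + c) = w - 1 \<and> a \<le> A \<and> b \<le> B \<and> c \<le> C"
    by cases (use box_weightD[OF assms] in fastforce)+
qed

lemma box_weight_raise: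
  assumes "box_weight A B C w d"
  shows "box_weight A B C (w + 1) (raise A B C d)"
  unfolding box_weight_def
proof (intro allI impI)
  fix a b c assume "raise A B C d a b c \<noteq> 0"
  then have "(case a of 0 \<Rightarrow> 0 | Suc a' \<Rightarrow> (of_nat A - of_nat a') * d a' b c) \<noteq> 0
    \<or> (case b of 0 \<Rightarrow> 0 | Suc b' \<Rightarrow> (of_nat B - of_nat b') * d a b' c) \<noteq> 0
    \<or> (case c of 0 \<Rightarrow> 0 | Suc c' \<Rightarrow> (of_nat C - of_nat c') * d a b c') \<noteq> 0"
    unfolding raise_def by (metis add.right_neutral)
  then consider a' where "a = Suc a'" "d a' b c \<noteq> 0" "a' \<noteq> A"
    | b' where "b = Suc b'" "d a b' c \<noteq> 0" "b' \<noteq> B"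
    | c' where "c = Suc c'" "d a b c' \<noteq> 0" "c' \<noteq> C"
    by (auto split: nat.splits)
  then show "int (a + b + c) = w + 1 \<and> a \<le> A \<and> b \<le> B \<and> c \<le> C"
    by cases (use box_weightD[OF assms] in fastforce)+
qed

lemma box_weight_add:
  "box_weight A B C w d \<Longrightarrow> box_weight A B C w e \<Longrightarrow> box_weight A B C w (\<lambda>a b c. d a b c + r * e a b c)"
  unfolding box_weight_def by (metis add.right_neutral mult_zero_right)

text \<open>Moving \<open>raise\<close> past \<open>k + 1\<close> lowerings picks up the weights
  \<open>A + B + C - 2 * (w - i)\<close> for \<open>i\<close> from 0 to \<open>k\<close>; the factor
  is their sum.\<close>

lemma lower_pow_raise:
  assumes "box_weight A B C w d"
  shows "(lower ^^ Suc k) (raise A B C d) =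
    (\<lambda>a b c. raise A B C ((lower ^^ Suc k) d) a b c
      + of_nat (Suc k) * (of_nat (A + B + C) - 2 * of_int w + of_nat k) * (lower ^^ k) d a b c)"
  using assms
proof (induction k arbitrary: w d)
  case 0
  have "(of_nat (A + B + C) - 2 * of_nat (a + b + c)) * d a b c
     = (of_nat (A + B + C) - 2 * of_int w) * d a b c" for a b c
  proof (cases "d a b c = 0")
    case False
    then have "w = int (a + b + c)" using 0 by (auto simp: box_weight_def)
    then show ?thesis by simp
  qed simp
  then show ?case by (intro ext) (simp add: lower_raise)
next
  case (Suc k)
  have "lower (raise A B C d) = (\<lambda>a b c. raise A B C (lower d) a b c
      + (of_nat (A + B + C) - 2 * of_int w) * d a b c)"
  proof (intro ext)
    fix a b c
    show "lower (raise A B C d) a b c = raise A B C (lower d) a b c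
      + (of_nat (A + B + C) - 2 * of_int w) * d a b c"
    proof (cases "d a b c = 0")
      case False
      then have "w = int (a + b + c)" using Suc.prems by (auto simp: box_weight_def)
      then show ?thesis by (simp add: lower_raise)
    qed (simp add: lower_raise)
  qed
  then have "(lower ^^ Suc (Suc k)) (raise A B C d) =
     (\<lambda>a b c. (lower ^^ Suc k) (raise A B C (lower d)) a b c
      + (of_nat (A + B + C) - 2 * of_int w) * (lower ^^ Suc k) d a b c)"
    unfolding funpow_Suc_right[of "Suc k" lower] o_def by (simp only: lower_pow_add)
  also have "\<dots> = (\<lambda>a b c. raise A B C ((lower ^^ Suc (Suc k)) d) a b c
      + of_nat (Suc (Suc k)) * (of_nat (A + B + C) - 2 * of_int w + of_nat (Suc k)) * (lower ^^ Suc k) d a b c)"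
    unfolding Suc.IH[OF box_weight_lower[OF Suc.prems]]
    by (intro ext) (simp add: funpow_swap1 algebra_simps)
  finally show ?case .
qed

text \<open>Induction on the number of lowerings that kill \<open>d\<close>. Below the middle weight
  the factor \<open>r\<close> of \<open>lower_pow_raise\<close> is positive. Moreover
  \<open>lower (raise A B C d)\<close> and \<open>r * d\<close> agree after \<open>k\<close>
  lowerings, so the induction hypothesis gives a preimage of their difference, and this yields one
  of \<open>d\<close>.\<close>

lemma lower_surj_aux:
  assumes "box_weight A B C w d" "2 * w < int (A + B + C)" "\<And>a b c. (lower ^^ k) d a b c = 0"
  shows "\<exists>e. box_weight A B C (w + 1) e \<and> lower e = d"
  using assms
proof (induction k arbitrary: d)
  case 0
  then have "d = (\<lambda>a b c. 0)" by (intro ext) simp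
  then show ?case by (intro exI[of _ "\<lambda>a b c. 0"]) (auto simp: box_weight_def lower_def)
next
  case (Suc k)
  define r :: rat where "r = of_nat (Suc k) * (of_nat (A + B + C) - 2 * of_int w + of_nat k)"
  have "of_int (2 * w) < (of_int (int (A + B + C)) :: rat)" using Suc.prems(2) by (simp only: of_int_less_iff)
  then have "0 < of_nat (A + B + C) - 2 * (of_int w :: rat) + of_nat k" by simp
  then have r: "r \<noteq> 0" by (simp add: r_def)
  define d' where "d' = (\<lambda>a b c. lower (raise A B C d) a b c + (- r) * d a b c)"
  have "box_weight A B C w (lower (raise A B C d))"
    using box_weight_lower[OF box_weight_raise[OF Suc.prems(1)]] by simp
  then have "box_weight A B C w d'"
    unfolding d'_def by (intro box_weight_add Suc.prems(1))
  moreover have "(lower ^^ k) d' a b c = 0" for a b c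
  proof -
    have z: "(lower ^^ Suc k) d = (\<lambda>a b c. 0)" using Suc.prems(3) by (intro ext)
    have "(lower ^^ k) (lower (raise A B C d)) = (lower ^^ Suc k) (raise A B C d)"
      by (simp only: funpow_Suc_right o_def)
    also have "\<dots> = (\<lambda>a b c. r * (lower ^^ k) d a b c)"
      unfolding lower_pow_raise[OF Suc.prems(1)] z r_def by (intro ext) (simp add: raise_def split: nat.splits)
    finally show ?thesis by (simp add: d'_def lower_pow_add del: minus_mult_minus mult_minus_left) 
  qed
  ultimately obtain e where e: "box_weight A B C (w + 1) e" "lower e = d'"
    using Suc.IH Suc.prems(2) by blast
  \<comment> \<open>Solve \<open>d' = lower (raise A B C d) - r * d\<close> for \<open>d\<close>,
    where \<open>e\<close> is a preimage of \<open>d'\<close>.\<close>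
  have "lower (\<lambda>a b c. 1 / r * (raise A B C d a b c) + (- 1 / r) * e a b c) a b c = d a b c" for a b c
  proof -
    have "lower (\<lambda>a b c. 1 / r * (raise A B C d a b c) + (- 1 / r) * e a b c) a b c
        = 1 / r * lower (raise A B C d) a b c + (- 1 / r) * lower e a b c"
      by (rule lower_linear)
    then show ?thesis using r by (simp add: e(2) d'_def field_simps)
  qed
  moreover have "box_weight A B C (w + 1) (\<lambda>a b c. 1 / r * (raise A B C d a b c) + (- 1 / r) * e a b c)"
    using box_weight_raise[OF Suc.prems(1)] by (intro box_weight_add e) (auto simp: box_weight_def)
  ultimately show ?case by (intro exI conjI ext)
qed

lemma lower_surj:
  assumes "box_weight A B C (int w) d" "2 * w < A + B + C"
  obtains e where "box_weight A B C (int (Suc w)) e" "lower e = d"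
proof -
  \<comment> \<open>After \<open>w + 1\<close> lowerings the weight is -1, which forces the zero
    function.\<close>
  have "box_weight A B C (int w - int k) ((lower ^^ k) d)" for k
  proof (induction k)
    case (Suc k)
    have "int w - int (Suc k) = int w - int k - 1" by simp
    then show ?case using box_weight_lower[OF Suc.IH] by (simp only: funpow.simps o_def)
  qed (use assms(1) in simp)
  from box_weightD[OF this[of "Suc w"]] have "(lower ^^ Suc w) d a b c = 0" for a b c
    by force
  with lower_surj_aux[OF assms(1), of "Suc w"] assms(2)
  obtain e where "box_weight A B C (int w + 1) e" "lower e = d" by force
  with that[of e] show ?thesis by (simp add: add.commute)
qed

text \<open>The box sizes are the largest \<open>a\<close>, \<open>b\<close>, \<open>c\<close> for
  which \<open>2 * j + 1 - 3 * a\<close>, \<open>2 * j - 3 * b\<close> and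
  \<open>2 * j - 3 * c\<close> stay nonnegative; these will be the exponents of \<open>x\<close>,
  \<open>y\<close>, \<open>z\<close>.\<close>

lemma coefficients_exist:
  obtains d :: "nat \<Rightarrow> nat \<Rightarrow> nat \<Rightarrow> nat \<Rightarrow> rat"
  where "d 0 = (\<lambda>a b c. if a = 0 \<and> b = 0 \<and> c = 0 then 1 else 0)"
    "\<And>j. box_weight ((2 * j + 1) div 3) (2 * j div 3) (2 * j div 3) (int j) (d j)"
    "\<And>j. lower (d (Suc j)) = d j"
proof -
  define P where "P j = box_weight ((2 * j + 1) div 3) (2 * j div 3) (2 * j div 3) (int j)" for j
  define d0 :: "nat \<Rightarrow> nat \<Rightarrow> nat \<Rightarrow> rat"
    where "d0 = (\<lambda>a b c. if a = 0 \<and> b = 0 \<and> c = 0 then 1 else 0)"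
  have "\<exists>d. \<forall>j. (P j (d j) \<and> (j = 0 \<longrightarrow> d j = d0)) \<and> lower (d (Suc j)) = d j"
  proof (rule dependent_nat_choice)
    show "\<exists>e. P 0 e \<and> (0 = (0::nat) \<longrightarrow> e = d0)"
      by (intro exI[of _ d0]) (auto simp: P_def d0_def box_weight_def)
  next
    fix e j assume "P j e \<and> (j = 0 \<longrightarrow> e = d0)"
    then have e: "P j e" by blast
    define A B where "A = (2 * Suc j + 1) div 3" and "B = 2 * Suc j div 3"
    have le: "(2 * j + 1) div 3 \<le> A" "2 * j div 3 \<le> B"
      unfolding A_def B_def by (intro div_le_mono; simp)+
    have "box_weight A B B (int j) e"
      unfolding box_weight_def
      using box_weightD[OF e[unfolded P_def]] le by (meson order_trans)
    \<comment> \<open>This puts the weight \<open>j\<close> below the middle. If 3 divides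
      \<open>j\<close>, the difference is just 1 and is owed to the extra factor \<open>x\<close> in
      \<open>g_0\<close>.\<close>
    moreover have "2 * j < A + B + B"
      unfolding A_def B_def by presburger
    ultimately obtain e' where "box_weight A B B (int (Suc j)) e'" "lower e' = e"
      by (rule lower_surj)
    then show "\<exists>e'. (P (Suc j) e' \<and> (Suc j = 0 \<longrightarrow> e' = d0)) \<and> lower e' = e"
      unfolding P_def A_def B_def by blast
  qed
  then obtain d where "\<And>j. P j (d j)" "d 0 = d0" "\<And>j. lower (d (Suc j)) = d j" by blast
  with that[of d] show ?thesis by (simp add: P_def d0_def)
qed

section \<open>Elements of the kernel of Roberts' derivation\<close>

lemma const_add: "const (a + b) = const a + (const b :: ('i \<Rightarrow>\<^sub>0 nat) \<Rightarrow>\<^sub>0 'c::comm_ring_1)"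
  by (simp add: const_def single_add)

lemma const_mult: "const (a * b) = const a * (const b :: ('i \<Rightarrow>\<^sub>0 nat) \<Rightarrow>\<^sub>0 'c::comm_ring_1)"
  by (simp add: const_def mult_single)

lemma const_0 [simp]: "const 0 = 0"
  by (simp add: const_def)

lemma const_1 [simp]: "const 1 = (1 :: ('i \<Rightarrow>\<^sub>0 nat) \<Rightarrow>\<^sub>0 'c::comm_ring_1)"
  by (simp add: const_def)

lemma const_of_nat: "const (of_nat k) = (of_nat k :: ('i \<Rightarrow>\<^sub>0 nat) \<Rightarrow>\<^sub>0 'c::comm_ring_1)"
  by (simp add: const_def)

lemma sum_shift_atMost:
  fixes f g :: "nat \<Rightarrow> 'a::comm_monoid_add"
  assumes "f 0 = 0" "\<And>a. f (Suc a) = g a" "g (Suc j) = 0"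
  shows "(\<Sum>a\<le>Suc j. f a) = (\<Sum>a\<le>Suc j. g a)"
proof -
  have "(\<Sum>a\<le>Suc j. f a) = f 0 + (\<Sum>a\<le>j. f (Suc a))" by (rule sum.atMost_Suc_shift)
  then show ?thesis using assms by simp
qed

text \<open>If \<open>s\<close>, \<open>t\<close>, \<open>u\<close> are graded like
  \<open>x^3\<close>, \<open>y^3\<close>, \<open>z^3\<close>, this has the multidegree of
  \<open>x (x y z)^(2 j)\<close>. The subtractions are exact on the box of
  \<open>coefficients_exist\<close>.\<close>

definition roberts_monomial :: "nat \<Rightarrow> nat \<Rightarrow> nat \<Rightarrow> nat \<Rightarrow> qpoly"
  where "roberts_monomial j a b c =
    var 1 ^ (2 * j + 1 - 3 * a) * var 2 ^ (2 * j - 3 * b) * var 3 ^ (2 * j - 3 * c)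
    * (var 4 ^ a * var 5 ^ b * var 6 ^ c)"

lemma roberts_monomial_Suc:
  assumes "a \<le> (2 * j + 1) div 3" "b \<le> 2 * j div 3" "c \<le> 2 * j div 3"
  shows "roberts_monomial (Suc j) a b c = (var 1 * var 2 * var 3) ^ 2 * roberts_monomial j a b c"
proof -
  have less: "3 * a \<le> 2 * j + 1" "3 * b \<le> 2 * j" "3 * c \<le> 2 * j"
    using assms by (simp_all add: less_eq_div_iff_mult_less_eq mult.commute)
  have e: "2 * Suc j + 1 - 3 * a = 2 + (2 * j + 1 - 3 * a)"
    "2 * Suc j - 3 * b = 2 + (2 * j - 3 * b)" "2 * Suc j - 3 * c = 2 + (2 * j - 3 * c)"
    using less by simp_all
  show ?thesis unfolding roberts_monomial_def e power_add
    by (simp add: power_mult_distrib mult_ac)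
qed

lemma roberts_roberts_monomial:
  "roberts (roberts_monomial j a b c) =
     of_nat a * (var 1 ^ (2 * j + 1 - 3 * a) * var 1 ^ 3) * var 2 ^ (2 * j - 3 * b) * var 3 ^ (2 * j - 3 * c)
       * (var 4 ^ (a - 1) * var 5 ^ b * var 6 ^ c)
   + of_nat b * var 1 ^ (2 * j + 1 - 3 * a) * (var 2 ^ (2 * j - 3 * b) * var 2 ^ 3) * var 3 ^ (2 * j - 3 * c)
       * (var 4 ^ a * var 5 ^ (b - 1) * var 6 ^ c)
   + of_nat c * var 1 ^ (2 * j + 1 - 3 * a) * var 2 ^ (2 * j - 3 * b) * (var 3 ^ (2 * j - 3 * c) * var 3 ^ 3)
       * (var 4 ^ a * var 5 ^ b * var 6 ^ (c - 1))"
  unfolding roberts_monomial_def roberts_mult roberts_power roberts_var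
  by (simp add: algebra_simps)

text \<open>Roberts' derivation replaces one \<open>s\<close> by \<open>x^3\<close>, and likewise
  for \<open>t\<close> and \<open>u\<close>. This preserves the grading, so it acts on coefficients
  as \<open>lower\<close>; the monomials for \<open>j + 1\<close> and those for \<open>j\<close>
  differ by the factor \<open>(x y z)^2\<close>.\<close>

lemma roberts_sum_step:
  assumes e: "box_weight ((2 * Suc j + 1) div 3) (2 * Suc j div 3) (2 * Suc j div 3) (int (Suc j)) e"
    and d: "box_weight ((2 * j + 1) div 3) (2 * j div 3) (2 * j div 3) (int j) d"
    and ed: "lower e = d"
  shows "roberts (\<Sum>a\<le>Suc j. \<Sum>b\<le>Suc j. \<Sum>c\<le>Suc j. const (e a b c) * roberts_monomial (Suc j) a b c)
    = (var 1 * var 2 * var 3) ^ 2 * (\<Sum>a\<le>j. \<Sum>b\<le>j. \<Sum>c\<le>j. const (d a b c) * roberts_monomial j a b c)"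
proof -
  let ?M = "roberts_monomial (Suc j)"
  let ?x = "var 1 :: qpoly" and ?y = "var 2 :: qpoly" and ?z = "var 3 :: qpoly"
  let ?s = "var 4 :: qpoly" and ?t = "var 5 :: qpoly" and ?u = "var 6 :: qpoly"
  define ex ey where "ex a = 2 * Suc j + 1 - 3 * a" and "ey a = 2 * Suc j - 3 * a" for a
  \<comment> \<open>The \<open>f\<close> are the contributions of the derivatives with respect to
    \<open>s\<close>, \<open>t\<close>, \<open>u\<close>; the \<open>g\<close> are the same terms
    reindexed by the lowered exponent.\<close>
  define f1 where "f1 a b c = const (e a b c) * (of_nat a * (?x ^ ex a * ?x ^ 3) * ?y ^ ey b * ?z ^ ey c
       * (?s ^ (a - 1) * ?t ^ b * ?u ^ c))" for a b c
  define f2 where "f2 a b c = const (e a b c) * (of_nat b * ?x ^ ex a * (?y ^ ey b * ?y ^ 3) * ?z ^ ey c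
       * (?s ^ a * ?t ^ (b - 1) * ?u ^ c))" for a b c
  define f3 where "f3 a b c = const (e a b c) * (of_nat c * ?x ^ ex a * ?y ^ ey b * (?z ^ ey c * ?z ^ 3)
       * (?s ^ a * ?t ^ b * ?u ^ (c - 1)))" for a b c
  define g1 where "g1 a b c = const (of_nat (a + 1) * e (a + 1) b c) * ?M a b c" for a b c
  define g2 where "g2 a b c = const (of_nat (b + 1) * e a (b + 1) c) * ?M a b c" for a b c
  define g3 where "g3 a b c = const (of_nat (c + 1) * e a b (c + 1)) * ?M a b c" for a b c
  note ew = box_weightD[OF e] and dw = box_weightD[OF d]
  have cm: "const (of_nat (Suc k) * r) = (of_nat (Suc k) * const r :: qpoly)" for k r
    by (simp only: const_mult const_of_nat)
  have mM: "?M a b c = ?x ^ ex a * ?y ^ ey b * ?z ^ ey c * (?s ^ a * ?t ^ b * ?u ^ c)" for a b c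
    by (simp only: roberts_monomial_def ex_def ey_def)
  have s1: "f1 (Suc a) b c = g1 a b c" for a b c
  \<comment> \<open>Outside the box truncation may spoil the exponents of \<open>x\<close>, but
    there the coefficient is zero.\<close>
  proof (cases "e (Suc a) b c = 0")
    case False
    then have "ex (Suc a) + 3 = ex a" using ew unfolding ex_def by fastforce
    then have "?x ^ ex (Suc a) * ?x ^ 3 = ?x ^ ex a" by (simp only: power_add[symmetric])
    then show ?thesis
      unfolding f1_def g1_def mM Suc_eq_plus1[symmetric] cm diff_Suc_1 by (simp only: mult_ac)
  qed (simp add: f1_def g1_def)
  have s2: "f2 a (Suc b) c = g2 a b c" for a b c
  proof (cases "e a (Suc b) c = 0")
    case False
    then have "ey (Suc b) + 3 = ey b" using ew unfolding ey_def by fastforce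
    then have "?y ^ ey (Suc b) * ?y ^ 3 = ?y ^ ey b" by (simp only: power_add[symmetric])
    then show ?thesis
      unfolding f2_def g2_def mM Suc_eq_plus1[symmetric] cm diff_Suc_1 by (simp only: mult_ac)
  qed (simp add: f2_def g2_def)
  have s3: "f3 a b (Suc c) = g3 a b c" for a b c
  proof (cases "e a b (Suc c) = 0")
    case False
    then have "ey (Suc c) + 3 = ey c" using ew unfolding ey_def by fastforce
    then have "?z ^ ey (Suc c) * ?z ^ 3 = ?z ^ ey c" by (simp only: power_add[symmetric])
    then show ?thesis
      unfolding f3_def g3_def mM Suc_eq_plus1[symmetric] cm diff_Suc_1 by (simp only: mult_ac)
  qed (simp add: f3_def g3_def)
  \<comment> \<open>All exponents add up to \<open>j + 1\<close>, so the boundary terms of the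
    shifted sums vanish.\<close>
  have e0: "e (Suc (Suc j)) b c = 0" "e a (Suc (Suc j)) c = 0" "e a b (Suc (Suc j)) = 0" for a b c
    using ew[of "Suc (Suc j)" b c] ew[of a "Suc (Suc j)" c] ew[of a b "Suc (Suc j)"] by linarith+
  have z: "f1 0 b c = 0" "f2 a 0 c = 0" "f3 a b 0 = 0" "g1 (Suc j) b c = 0" "g2 a (Suc j) c = 0" "g3 a b (Suc j) = 0" for a b c
    by (simp_all add: f1_def f2_def f3_def g1_def g2_def g3_def e0)
  let ?A = "{..Suc j}"
  have "roberts (\<Sum>a\<in>?A. \<Sum>b\<in>?A. \<Sum>c\<in>?A. const (e a b c) * ?M a b c)
     = (\<Sum>a\<in>?A. \<Sum>b\<in>?A. \<Sum>c\<in>?A. f1 a b c + f2 a b c + f3 a b c)"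
    unfolding roberts_sum roberts_mult roberts_const roberts_roberts_monomial f1_def f2_def f3_def ex_def ey_def
    by (simp only: mult_zero_left add_0_left distrib_left)
  also have "\<dots> = (\<Sum>a\<in>?A. \<Sum>b\<in>?A. \<Sum>c\<in>?A. f1 a b c) + (\<Sum>a\<in>?A. \<Sum>b\<in>?A. \<Sum>c\<in>?A. f2 a b c)
      + (\<Sum>a\<in>?A. \<Sum>b\<in>?A. \<Sum>c\<in>?A. f3 a b c)"
    by (simp only: sum.distrib)
  also have "(\<Sum>a\<in>?A. \<Sum>b\<in>?A. \<Sum>c\<in>?A. f1 a b c) = (\<Sum>a\<in>?A. \<Sum>b\<in>?A. \<Sum>c\<in>?A. g1 a b c)"
    by (rule sum_shift_atMost) (simp_all only: s1 z sum.neutral_const)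
  also have "(\<Sum>a\<in>?A. \<Sum>b\<in>?A. \<Sum>c\<in>?A. f2 a b c) = (\<Sum>a\<in>?A. \<Sum>b\<in>?A. \<Sum>c\<in>?A. g2 a b c)"
    by (intro sum.cong refl sum_shift_atMost) (simp_all only: s2 z sum.neutral_const)
  also have "(\<Sum>a\<in>?A. \<Sum>b\<in>?A. \<Sum>c\<in>?A. f3 a b c) = (\<Sum>a\<in>?A. \<Sum>b\<in>?A. \<Sum>c\<in>?A. g3 a b c)"
    by (intro sum.cong refl sum_shift_atMost) (simp_all only: s3 z)
  also have "(\<Sum>a\<in>?A. \<Sum>b\<in>?A. \<Sum>c\<in>?A. g1 a b c) + (\<Sum>a\<in>?A. \<Sum>b\<in>?A. \<Sum>c\<in>?A. g2 a b c)
      + (\<Sum>a\<in>?A. \<Sum>b\<in>?A. \<Sum>c\<in>?A. g3 a b c)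
     = (\<Sum>a\<in>?A. \<Sum>b\<in>?A. \<Sum>c\<in>?A. const (lower e a b c) * ?M a b c)"
    unfolding sum.distrib[symmetric] g1_def g2_def g3_def
    by (simp only: lower_def const_add distrib_right)
  also have "\<dots> = (\<Sum>a\<in>?A. \<Sum>b\<in>?A. \<Sum>c\<in>?A. (?x * ?y * ?z) ^ 2 * (const (d a b c) * roberts_monomial j a b c))"
  proof (intro sum.cong refl)
    fix a b c
    show "const (lower e a b c) * ?M a b c = (?x * ?y * ?z) ^ 2 * (const (d a b c) * roberts_monomial j a b c)"
    proof (cases "d a b c = 0")
      case False
      then have "?M a b c = (?x * ?y * ?z) ^ 2 * roberts_monomial j a b c"
        using dw by (intro roberts_monomial_Suc) blast+
      then show ?thesis unfolding ed by (simp only: mult_ac)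
    qed (simp add: ed)
  qed
  also have "\<dots> = (?x * ?y * ?z) ^ 2 * (\<Sum>a\<le>j. \<Sum>b\<le>j. \<Sum>c\<le>j. const (d a b c) * roberts_monomial j a b c)"
  proof -
    have d0: "d (Suc j) b c = 0" "d a (Suc j) c = 0" "d a b (Suc j) = 0" for a b c
      using dw[of "Suc j" b c] dw[of a "Suc j" c] dw[of a b "Suc j"] by linarith+
    show ?thesis by (simp add: d0 sum_distrib_left)
  qed
  finally show ?thesis .
qed

lemma roberts_chain:
  obtains g :: "nat \<Rightarrow> qpoly" where "g 0 = var 1" "\<And>j. indets (g j) \<subseteq> {1..6}"
    "\<And>j. roberts (g (Suc j)) = (var 1 * var 2 * var 3) ^ 2 * g j"
proof -
  obtain d where d: "d 0 = (\<lambda>a b c. if a = 0 \<and> b = 0 \<and> c = 0 then 1 else 0)"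
    "\<And>j. box_weight ((2 * j + 1) div 3) (2 * j div 3) (2 * j div 3) (int j) (d j)"
    "\<And>j. lower (d (Suc j)) = d j"
    by (rule coefficients_exist) blast
  define g where "g j = (\<Sum>a\<le>j. \<Sum>b\<le>j. \<Sum>c\<le>j. const (d j a b c) * roberts_monomial j a b c)" for j
  show ?thesis
  proof
    show "g 0 = var 1" by (simp add: g_def d(1) roberts_monomial_def)
    show "indets (g j) \<subseteq> {1..6}" for j
      unfolding g_def roberts_monomial_def by (intro indets_sumI indets_multI indets_powerI) auto
    show "roberts (g (Suc j)) = (var 1 * var 2 * var 3) ^ 2 * g j" for j
      unfolding g_def by (rule roberts_sum_step) (use d in blast)+
  qed
qed

lemma keys_subset_indets: "Poly_Mapping.lookup p m \<noteq> 0 \<Longrightarrow> Poly_Mapping.keys m \<subseteq> indets p"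
  by (auto simp: indets_def in_keys_iff)

text \<open>Since \<open>D h_j = - (x y z)^2 h_(j+1)\<close>, the image of the sum telescopes, and
  both end terms are zero. As no \<open>g_j\<close> contains \<open>v\<close>, the monomial
  \<open>x v^n\<close> can only come from \<open>j = 0\<close>.\<close>

lemma roberts_kernel_element:
  obtains f :: qpoly where "roberts f = 0" "indets f \<subseteq> {1..7}"
    "Poly_Mapping.lookup f (Poly_Mapping.single 1 1 + Poly_Mapping.single 7 n) \<noteq> 0"
proof -
  obtain g where g: "g 0 = var 1" "\<And>j. indets (g j) \<subseteq> {1..6}"
    "\<And>j. roberts (g (Suc j)) = (var 1 * var 2 * var 3) ^ 2 * g j"
    by (rule roberts_chain) blast
  let ?Q = "(var 1 * var 2 * var 3) ^ 2 :: qpoly"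
  define h :: "nat \<Rightarrow> qpoly" where "h j = const ((-1) ^ j / fact (n - j)) * var 7 ^ (n - j)" for j
  define f where "f = (\<Sum>j\<le>n. h j * g j)"
  have h1: "roberts (h j) = - (?Q * h (Suc j))" if "j < n" for j
  proof -
    have r: "(-1) ^ j / fact (n - j) * of_nat (n - j) = - ((-1) ^ Suc j / fact (n - Suc j) :: rat)"
      using that by (simp add: fact_reduce[of "n - j"] field_simps Suc_diff_Suc)
    have "roberts (h j) = (const ((-1) ^ j / fact (n - j)) * const (of_nat (n - j))) * var 7 ^ (n - Suc j) * ?Q"
      by (simp add: h_def roberts_mult roberts_power roberts_var const_of_nat mult_ac)
    also have "const ((-1) ^ j / fact (n - j)) * const (of_nat (n - j)) = - (const ((-1) ^ Suc j / fact (n - Suc j)) :: qpoly)"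
      unfolding const_mult[symmetric] r by (simp add: const_def single_uminus)
    finally show ?thesis by (simp add: h_def mult_ac)
  qed
  have h2: "roberts (h n) = 0" by (simp add: h_def)
  have g0: "roberts (g 0) = 0" by (simp add: g(1) roberts_var)
  have "roberts f = (\<Sum>j\<le>n. roberts (h j) * g j) + (\<Sum>j\<le>n. h j * roberts (g j))"
    by (simp add: f_def roberts_sum roberts_mult sum.distrib)
  also have "(\<Sum>j\<le>n. roberts (h j) * g j) = (\<Sum>j<n. - (?Q * h (Suc j)) * g j)"
    by (simp add: lessThan_Suc_atMost[symmetric] h2 h1)
  also have "(\<Sum>j\<le>n. h j * roberts (g j)) = (\<Sum>j<n. h (Suc j) * (?Q * g j))"
    by (simp add: sum.atMost_shift g0 g(3))
  finally have "roberts f = 0"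
    unfolding sum.distrib[symmetric] by (simp add: mult_ac)
  moreover have "indets f \<subseteq> {1..7}"
    unfolding f_def h_def using g(2) by (intro indets_sumI indets_multI indets_powerI) fastforce+
  moreover have "Poly_Mapping.lookup f (Poly_Mapping.single 1 1 + Poly_Mapping.single 7 n) \<noteq> 0"
  proof -
    have l: "Poly_Mapping.lookup (h j * g j) (Poly_Mapping.single 1 1 + Poly_Mapping.single 7 n)
       = (-1) ^ j / fact (n - j) * Poly_Mapping.lookup (g j) (Poly_Mapping.single 1 1 + Poly_Mapping.single 7 j)"
      if "j \<le> n" for j
    proof -
      have h: "h j = Poly_Mapping.single (Poly_Mapping.single 7 (n - j)) ((-1) ^ j / fact (n - j))"
        by (simp add: h_def var_power const_def mult_single)
      have m: "Poly_Mapping.single 1 1 + Poly_Mapping.single 7 n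
        = Poly_Mapping.single 7 (n - j) + (Poly_Mapping.single 1 1 + Poly_Mapping.single (7::nat) j)"
        using that by (simp add: ac_simps flip: single_add)
      show ?thesis unfolding h m by (rule lookup_single_mult_add)
    qed
    have z: "Poly_Mapping.lookup (g j) (Poly_Mapping.single 1 1 + Poly_Mapping.single 7 j) = 0" if "j \<noteq> 0" for j
    proof (rule ccontr)
      assume "Poly_Mapping.lookup (g j) (Poly_Mapping.single 1 1 + Poly_Mapping.single 7 j) \<noteq> 0"
      then have "Poly_Mapping.keys (Poly_Mapping.single 1 1 + Poly_Mapping.single 7 j) \<subseteq> indets (g j)"
        by (rule keys_subset_indets)
      moreover have "7 \<in> Poly_Mapping.keys (Poly_Mapping.single 1 1 + Poly_Mapping.single (7::nat) j)"
        using that by (simp add: in_keys_iff lookup_add lookup_single)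
      ultimately show False using g(2)[of j] by auto
    qed
    have "Poly_Mapping.lookup f (Poly_Mapping.single 1 1 + Poly_Mapping.single 7 n)
        = (\<Sum>j\<le>n. if j = 0 then 1 / fact n else 0)"
      unfolding f_def lookup_sum
    proof (intro sum.cong refl)
      fix j assume "j \<in> {..n}"
      then show "Poly_Mapping.lookup (h j * g j) (Poly_Mapping.single 1 1 + Poly_Mapping.single 7 n)
          = (if j = 0 then 1 / fact n else 0)"
        using z[of j] by (subst l) (auto simp: g(1) var_def)
    qed
    then show ?thesis by simp
  qed
  ultimately show ?thesis by (rule that)
qed

text \<open>Excluding the pure powers of \<open>v\<close>, as \<open>roberts_kernel_coeff\<close>
  permits, is what makes the bound on \<open>x v^k\<close> stable under products.\<close>

definition bounded_part :: "nat \<Rightarrow> qpoly set"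
  where "bounded_part N = {p. (\<forall>k. Poly_Mapping.lookup p (Poly_Mapping.single 7 (Suc k)) = 0) \<and>
    (\<forall>k>N. Poly_Mapping.lookup p (Poly_Mapping.single 1 1 + Poly_Mapping.single 7 k) = 0)}"

lemma single_eq_add_split:
  assumes "Poly_Mapping.single (7::nat) k = a + (b :: nat \<Rightarrow>\<^sub>0 nat)"
  shows "\<exists>i j. a = Poly_Mapping.single 7 i \<and> b = Poly_Mapping.single 7 j \<and> k = i + j"
proof -
  have e: "Poly_Mapping.lookup (Poly_Mapping.single 7 k) i = Poly_Mapping.lookup a i + Poly_Mapping.lookup b i" for i
    unfolding assms by (simp add: lookup_add)
  have "Poly_Mapping.lookup a i = 0 \<and> Poly_Mapping.lookup b i = 0" if "i \<noteq> 7" for i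
    using e[of i] that by (simp add: lookup_single)
  then have "a = Poly_Mapping.single 7 (Poly_Mapping.lookup a 7)" "b = Poly_Mapping.single 7 (Poly_Mapping.lookup b 7)"
    by (auto intro!: poly_mapping_eqI simp: lookup_single when_def)
  with e[of 7] show ?thesis by auto
qed

lemma single_eq_add_split':
  assumes "Poly_Mapping.single 1 1 + Poly_Mapping.single (7::nat) k = a + (b :: nat \<Rightarrow>\<^sub>0 nat)"
  shows "\<exists>i j. k = i + j \<and>
    (a = Poly_Mapping.single 1 1 + Poly_Mapping.single 7 i \<and> b = Poly_Mapping.single 7 j \<or>
     a = Poly_Mapping.single 7 i \<and> b = Poly_Mapping.single 1 1 + Poly_Mapping.single 7 j)"
proof -
  have e: "Poly_Mapping.lookup (Poly_Mapping.single 1 1 + Poly_Mapping.single 7 k) i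
      = Poly_Mapping.lookup a i + Poly_Mapping.lookup b i" for i
    unfolding assms by (simp add: lookup_add)
  have z: "Poly_Mapping.lookup a i = 0 \<and> Poly_Mapping.lookup b i = 0" if "i \<noteq> 7" "i \<noteq> 1" for i
    using e[of i] that by (simp add: lookup_single lookup_add)
  have 1: "Poly_Mapping.lookup a 1 + Poly_Mapping.lookup b 1 = 1"
    and 7: "Poly_Mapping.lookup a 7 + Poly_Mapping.lookup b 7 = k"
    using e[of 1] e[of 7] by (simp_all add: lookup_single lookup_add)
  have "c = Poly_Mapping.single 1 (Poly_Mapping.lookup c 1) + Poly_Mapping.single 7 (Poly_Mapping.lookup c 7)"
    if "c \<in> {a, b}" for c
    using z that by (auto intro!: poly_mapping_eqI simp: lookup_single lookup_add when_def)
  from this[of a] this[of b]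
  have ab: "a = Poly_Mapping.single 1 (Poly_Mapping.lookup a 1) + Poly_Mapping.single 7 (Poly_Mapping.lookup a 7)"
    "b = Poly_Mapping.single 1 (Poly_Mapping.lookup b 1) + Poly_Mapping.single 7 (Poly_Mapping.lookup b 7)" by auto
  consider "Poly_Mapping.lookup a 1 = 1" "Poly_Mapping.lookup b 1 = 0"
    | "Poly_Mapping.lookup a 1 = 0" "Poly_Mapping.lookup b 1 = 1" using 1 by linarith
  then show ?thesis
    by cases (use ab 7 in \<open>(intro exI[of _ "Poly_Mapping.lookup a 7"] exI[of _ "Poly_Mapping.lookup b 7"], simp)\<close>)+
qed

text \<open>The monomial \<open>x v^k\<close> only splits into \<open>x v^i\<close> and
  \<open>v^j\<close>, and the latter contributes only for \<open>j = 0\<close>. So the exponent of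
  \<open>v\<close> does not grow.\<close>

lemma bounded_part_mult:
  assumes "p \<in> bounded_part N" "q \<in> bounded_part N"
  shows "p * q \<in> bounded_part N"
proof -
  have v: "Poly_Mapping.lookup r (Poly_Mapping.single 7 k) = 0" if "r \<in> {p, q}" "k \<noteq> 0" for r k
    using assms that by (cases k) (auto simp: bounded_part_def)
  have xv: "Poly_Mapping.lookup r (Poly_Mapping.single 1 1 + Poly_Mapping.single 7 k) = 0" if "r \<in> {p, q}" "k > N" for r k
    using assms that by (auto simp: bounded_part_def)
  have "Poly_Mapping.lookup (p * q) (Poly_Mapping.single 7 (Suc k)) = 0" for k
  proof (rule lookup_mult_eq_0I)
    fix a b :: "nat \<Rightarrow>\<^sub>0 nat" assume "Poly_Mapping.single 7 (Suc k) = a + b"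
    then obtain i j where "a = Poly_Mapping.single 7 i" "b = Poly_Mapping.single 7 j" "Suc k = i + j"
      using single_eq_add_split by blast
    then show "Poly_Mapping.lookup p a * Poly_Mapping.lookup q b = 0"
      using v[of p i] v[of q j] by (cases "i = 0") auto
  qed
  moreover have "Poly_Mapping.lookup (p * q) (Poly_Mapping.single 1 1 + Poly_Mapping.single 7 k) = 0" if "k > N" for k
  proof (rule lookup_mult_eq_0I)
    fix a b :: "nat \<Rightarrow>\<^sub>0 nat" assume "Poly_Mapping.single 1 1 + Poly_Mapping.single 7 k = a + b"
    then obtain i j where ij: "k = i + j" and
      "a = Poly_Mapping.single 1 1 + Poly_Mapping.single 7 i \<and> b = Poly_Mapping.single 7 j \<or>
       a = Poly_Mapping.single 7 i \<and> b = Poly_Mapping.single 1 1 + Poly_Mapping.single 7 j"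
      using single_eq_add_split' by blast
    then consider "a = Poly_Mapping.single 1 1 + Poly_Mapping.single 7 i" "b = Poly_Mapping.single 7 j"
      | "a = Poly_Mapping.single 7 i" "b = Poly_Mapping.single 1 1 + Poly_Mapping.single 7 j" by blast
    then show "Poly_Mapping.lookup p a * Poly_Mapping.lookup q b = 0"
    proof cases
      case 1
      then show ?thesis using v[of q j] xv[of p i] ij \<open>k > N\<close> by (cases "j = 0") auto
    next
      case 2
      then show ?thesis using v[of p i] xv[of q j] ij \<open>k > N\<close> by (cases "i = 0") auto
    qed
  qed
  ultimately show ?thesis by (simp add: bounded_part_def)
qed

section \<open>Generic points\<close>

text \<open>A polynomial is determined by the finite graph of its nonzero coefficients. Countability
  of \<open>qpoly\<close> is what leaves room for generic points.\<close>

instance poly_mapping :: (countable, "{countable, zero}") countable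
proof
  let ?g = "\<lambda>p :: 'a \<Rightarrow>\<^sub>0 'b. (\<lambda>k. (k, Poly_Mapping.lookup p k)) ` Poly_Mapping.keys p"
  have "inj ?g"
  proof (rule injI, rule poly_mapping_eqI)
    fix p q :: "'a \<Rightarrow>\<^sub>0 'b" and k
    assume eq: "?g p = ?g q"
    have "(k, v) \<in> ?g r \<longleftrightarrow> v = Poly_Mapping.lookup r k \<and> v \<noteq> 0" for r v
      by (auto simp: in_keys_iff)
    then show "Poly_Mapping.lookup p k = Poly_Mapping.lookup q k"
      using eq by metis
  qed
  moreover have "countable (range ?g)"
    by (rule countable_subset[OF _ countable_Collect_finite]) auto
  ultimately have "countable (UNIV :: ('a \<Rightarrow>\<^sub>0 'b) set)"
    by (simp add: countable_image_inj_eq)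
  then show "\<exists>to_nat :: ('a \<Rightarrow>\<^sub>0 'b) \<Rightarrow> nat. inj to_nat"
    by (auto elim: countableE)
qed

text \<open>There are countably many polynomials over \<open>K\<close>, and each nonzero one has
  finitely many roots.\<close>

lemma exists_transcendental:
  fixes K S :: "'a::idom set"
  assumes K: "countable K" and S: "uncountable S"
  obtains z where "z \<in> S" "\<And>p. (\<And>i. coeff p i \<in> K) \<Longrightarrow> poly p z = 0 \<Longrightarrow> p = 0"
proof -
  let ?P = "{p :: 'a poly. range (coeff p) \<subseteq> K}"
  have "coeffs ` ?P \<subseteq> lists K"
    by (auto simp: coeffs_def image_subset_iff)
  then have "countable (coeffs ` ?P)"
    using countable_lists[OF K] countable_subset by blast
  then have "countable ?P"
    by (rule countable_image_inj_on) (auto simp: inj_on_def coeffs_eq_iff)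
  then have "countable (\<Union>p\<in>?P - {0}. {z. poly p z = 0})"
    by (intro countable_UN) (auto intro: countable_finite poly_roots_finite)
  then have "S - (\<Union>p\<in>?P - {0}. {z. poly p z = 0}) \<noteq> {}"
    using uncountable_minus_countable[OF S] by (metis countable_empty)
  then obtain z where z: "z \<in> S" "z \<notin> (\<Union>p\<in>?P - {0}. {z. poly p z = 0})" by blast
  have "p = 0" if "\<And>i. coeff p i \<in> K" "poly p z = 0" for p
    using z(2) that by auto
  with that z(1) show ?thesis by blast
qed

lemma insertion_eq_0_no_indets:
  fixes p :: "('i \<Rightarrow>\<^sub>0 nat) \<Rightarrow>\<^sub>0 rat"
  assumes "indets p = {}" "insertion of_rat f p = (0::'a::field_char_0)"
  shows "p = 0"
proof -
  have "Poly_Mapping.keys p \<subseteq> {0}"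
    using assms(1) by (auto simp: indets_def)
  then have p: "p = const (Poly_Mapping.lookup p 0)"
    by (intro poly_mapping_eqI) (auto simp: const_def lookup_single when_def in_keys_iff)
  have "insertion of_rat f p = (of_rat (Poly_Mapping.lookup p 0) :: 'a)"
    by (subst p) simp
  with assms(2) p show ?thesis by (metis const_0 of_rat_eq_0_iff)
qed

text \<open>The coordinates are chosen one after another, each transcendental over the values of
  polynomials in the earlier ones. \<open>S i\<close> may depend on the earlier coordinates and has
  to be uncountable only for admissible ones; \<open>twisted\<close> relies on both.\<close>

lemma generic_point:
  fixes S :: "nat \<Rightarrow> (nat \<Rightarrow> 'a::field_char_0) \<Rightarrow> 'a set"
  assumes dep: "\<And>i g h. (\<And>j. j < i \<Longrightarrow> g j = h j) \<Longrightarrow> S i g = S i h"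
    and unc: "\<And>i g. (\<And>j. j < i \<Longrightarrow> g j \<in> S j g) \<Longrightarrow> uncountable (S i g)"
  obtains f where "\<And>i. f i \<in> S i f" "\<And>p. insertion of_rat f p = 0 \<Longrightarrow> p = 0"
proof -
  define K where "K i g = insertion of_rat g ` {p :: qpoly. indets p \<subseteq> {..<i}}" for i and g :: "nat \<Rightarrow> 'a"
  define tr where "tr i g z \<longleftrightarrow> (\<forall>q. (\<forall>k. coeff q k \<in> K i g) \<longrightarrow> poly q z = 0 \<longrightarrow> q = 0)" for i g z
  have K_cong: "K i g = K i h" if "\<And>j. j < i \<Longrightarrow> g j = h j" for i g h
    unfolding K_def using that by (intro image_cong insertion_cong) auto
  \<comment> \<open>\<open>G i\<close> is the function at stage \<open>i\<close>, of which the
    coordinates below \<open>i\<close> are final.\<close>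
  have "\<exists>G. \<forall>i. (\<forall>j<i. G i j \<in> S j (G i)) \<and> (\<exists>z\<in>S i (G i). tr i (G i) z \<and> G (Suc i) = (G i)(i := z))"
  proof (rule dependent_nat_choice)
    fix g i assume g: "\<forall>j<i. g j \<in> S j g"
    have "countable (K i g)" unfolding K_def by (intro countable_image) simp
    then obtain z where z: "z \<in> S i g" "tr i g z"
      using exists_transcendental unc[of i g] g unfolding tr_def by metis
    moreover have "(g(i := z)) j \<in> S j (g(i := z))" if "j < Suc i" for j
    proof -
      have "S j (g(i := z)) = S j g" using that by (intro dep) auto
      then show ?thesis using z(1) g that by (cases "j = i") auto
    qed
    ultimately show "\<exists>g'. (\<forall>j<Suc i. g' j \<in> S j g') \<and> (\<exists>z\<in>S i g. tr i g z \<and> g' = g(i := z))"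
      by (intro exI[of _ "g(i := z)"]) blast
  qed simp
  then obtain G where G: "\<And>i. \<exists>z\<in>S i (G i). tr i (G i) z \<and> G (Suc i) = (G i)(i := z)" by blast
  define f where "f i = G (Suc i) i" for i
  have Gf: "G k j = f j" if "j < k" for j k
    using that
  proof (induction k)
    case (Suc k)
    then show ?case
      using G[of k] by (cases "j = k") (auto simp: f_def)
  qed simp
  have f: "f i \<in> S i f \<and> tr i f (f i)" for i
  proof -
    have "S i (G i) = S i f" "K i (G i) = K i f"
      by (rule dep K_cong, simp add: Gf)+
    then show ?thesis using G[of i] by (auto simp: f_def tr_def)
  qed
  \<comment> \<open>Induction on the number of variables: transcendence of the last coordinate kills
    the univariate polynomial, and the induction hypothesis kills its coefficients.\<close>
  have "\<forall>p :: qpoly. indets p \<subseteq> {..<i} \<longrightarrow> insertion of_rat f p = 0 \<longrightarrow> p = 0" for i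
  proof (induction i)
    case 0
    then show ?case using insertion_eq_0_no_indets by auto
  next
    case (Suc i)
    show ?case
    proof (intro allI impI)
      fix p :: qpoly assume p: "indets p \<subseteq> {..<Suc i}" "insertion of_rat f p = 0"
      have ind: "indets (coeff_in i k p) \<subseteq> {..<i}" for k
        using indets_coeff_in[of i k p] p(1) by (fastforce simp: less_Suc_eq)
      have "insertion_poly i of_rat f p = 0"
        using f[of i] ind p(2) of_rat.poly_insertion_poly[of i f p]
        unfolding tr_def K_def by (auto simp: coeff_insertion_poly)
      then have "insertion of_rat f (coeff_in i k p) = 0" for k
        by (metis coeff_insertion_poly coeff_0 of_rat_0)
      then have "coeff_in i k p = 0" for k using Suc.IH ind by blast
      then show "p = 0" using coeff_in_nonzero by metis
    qed
  qed
  moreover have "\<exists>i. indets p \<subseteq> {..<i}" for p :: qpoly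
    using finite_nat_iff_bounded[of "indets p"] by simp
  ultimately have "\<And>p. insertion of_rat f p = 0 \<Longrightarrow> p = 0" by blast
  with f that show ?thesis by blast
qed

text \<open>No nonzero polynomial vanishes at a generic point, so fractions can be evaluated there.
  Cross-multiplication shows that the representative picked by \<open>SOME\<close> does not
  matter.\<close>

lemma generic_embedding:
  fixes f :: "nat \<Rightarrow> 'a::field_char_0"
  assumes f: "\<And>p. insertion of_rat f p = 0 \<Longrightarrow> p = 0"
  obtains E :: "ratfun \<Rightarrow> 'a" where "coeff_hom E"
    "\<And>p q. q \<noteq> 0 \<Longrightarrow> E (Fract p q) = insertion of_rat f p / insertion of_rat f q"
proof -
  define E where "E r = (case SOME (p, q). q \<noteq> 0 \<and> r = Fract p q of
      (p, q) \<Rightarrow> insertion of_rat f p / insertion of_rat f q)" for r :: ratfun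
  have E: "E (Fract p q) = insertion of_rat f p / insertion of_rat f q" if "q \<noteq> 0" for p q
  proof -
    obtain p' q' where s: "(SOME (p', q'). q' \<noteq> 0 \<and> Fract p q = Fract p' q') = (p', q')"
      by (cases "SOME (p', q'). q' \<noteq> 0 \<and> Fract p q = Fract p' q'") blast
    have "case (p', q') of (p', q') \<Rightarrow> q' \<noteq> 0 \<and> Fract p q = Fract p' q'"
      unfolding s[symmetric] by (rule someI[of _ "(p, q)"]) (use that in simp)
    then have q': "q' \<noteq> 0" and "Fract p q = Fract p' q'" by auto
    then have "p * q' = p' * q" using that by (simp add: eq_fract)
    then have "insertion of_rat f (p * q') = insertion of_rat f (p' * q)" by simp
    moreover have "insertion of_rat f q \<noteq> 0" "insertion of_rat f q' \<noteq> 0"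
      using f that q' by blast+
    ultimately show ?thesis by (simp add: E_def s field_simps)
  qed
  have "coeff_hom E"
  proof
    show "E 0 = 0" by (simp add: Zero_fract_def E)
    show "E 1 = 1" by (simp add: One_fract_def E)
    fix a b :: ratfun
    obtain p q where a: "a = Fract p q" "q \<noteq> 0" by (cases a)
    obtain p' q' where b: "b = Fract p' q'" "q' \<noteq> 0" by (cases b)
    have "insertion of_rat f q \<noteq> 0" "insertion of_rat f q' \<noteq> 0"
      using f a b by blast+
    then show "E (a + b) = E a + E b" "E (a * b) = E a * E b"
      using a b by (simp_all add: E field_simps)
  qed
  with E that show ?thesis by blast
qed

section \<open>Real and twisted points\<close>

lemma uncountable_Reals: "uncountable (\<real> :: complex set)"
  using uncountable_UNIV_real by (simp add: Reals_def countable_image_inj_eq inj_def)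

lemma real_embedding:
  "\<exists>f :: nat \<Rightarrow> complex. (\<forall>i. f i \<in> \<real>) \<and> (\<forall>p. insertion of_rat f p = 0 \<longrightarrow> p = 0)"
  by (rule generic_point[of "\<lambda>_ _. \<real>"]) (auto simp: uncountable_Reals)

text \<open>
  The indices 8, 9, 10 stand for \<open>T, m, b\<close>. With \<open>T = \<i> \<tau>\<close> the second case says that the complex
  conjugate of \<open>m\<close> is \<open>g / m\<close>, so that \<open>b m\<close>, \<open>b (m\<^sup>2 + g)\<close> and \<open>T b (m\<^sup>2 - g)\<close> are real.
\<close>

definition twisted :: "nat \<Rightarrow> (nat \<Rightarrow> complex) \<Rightarrow> complex set"
  where "twisted i f =
    (if i = 8 then {\<i> * of_real \<tau> | \<tau>. 1 < \<tau> \<and> \<tau>\<^sup>2 < 2}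
     else if i = 9 then {z. (cmod z)\<^sup>2 = ((cmod (f 8))\<^sup>2 - 1) * (2 - (cmod (f 8))\<^sup>2)}
     else if i = 10 then {of_real \<beta> / f 9 | \<beta>. \<beta> \<noteq> 0}
     else \<real>)"

text \<open>The real parts of the points on a circle cover an open interval.\<close>

lemma uncountable_circle:
  assumes "0 < r" shows "uncountable {z. (cmod z)\<^sup>2 = r}"
proof
  assume "countable {z. (cmod z)\<^sup>2 = r}"
  then have "countable (Re ` {z. (cmod z)\<^sup>2 = r})" by (rule countable_image)
  moreover have "{0<..<sqrt r} \<subseteq> Re ` {z. (cmod z)\<^sup>2 = r}"
  proof
    fix x assume "x \<in> {0<..<sqrt r}"
    then have "x\<^sup>2 < (sqrt r)\<^sup>2" by (intro power_strict_mono) auto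
    then have "(cmod (Complex x (sqrt (r - x\<^sup>2))))\<^sup>2 = r"
      using assms by (simp add: cmod_power2)
    then show "x \<in> Re ` {z. (cmod z)\<^sup>2 = r}"
      by (intro image_eqI[of _ _ "Complex x (sqrt (r - x\<^sup>2))"]) auto
  qed
  moreover have "uncountable {0<..<sqrt r}"
    using assms by (simp add: uncountable_open_interval)
  ultimately show False using countable_subset by blast
qed

text \<open>As the squared modulus of \<open>T\<close> lies strictly between 1 and 2, the circle for
  \<open>m\<close> has positive radius. So it is uncountable and avoids 0, which the division by
  \<open>m\<close> in the choice of \<open>b\<close> requires.\<close>

lemma twisted_uncountable:
  assumes "\<And>j. j < i \<Longrightarrow> f j \<in> twisted j f"
  shows "uncountable (twisted i f)"
proof -
  consider "i = 8" | "i = 9" | "i = 10" | "i \<notin> {8, 9, 10}" by blast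
  then show ?thesis
  proof cases
    case 1
    have "(\<lambda>\<tau>. \<i> * of_real \<tau>) ` {1<..<sqrt 2} \<subseteq> twisted i f"
    proof
      fix z assume "z \<in> (\<lambda>\<tau>. \<i> * of_real \<tau>) ` {1<..<sqrt 2}"
      then obtain \<tau> where t: "z = \<i> * of_real \<tau>" "1 < \<tau>" "\<tau> < sqrt 2" by auto
      then have "\<tau>\<^sup>2 < (sqrt 2)\<^sup>2" by (intro power_strict_mono) auto
      with t show "z \<in> twisted i f" by (auto simp: twisted_def 1)
    qed
    moreover have "uncountable ((\<lambda>\<tau>. \<i> * complex_of_real \<tau>) ` {1<..<sqrt 2})"
      by (subst countable_image_inj_eq) (auto simp: inj_on_def uncountable_open_interval)
    ultimately show ?thesis using countable_subset by blast
  next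
    case 2
    have "f 8 \<in> twisted 8 f" using assms 2 by simp
    then obtain \<tau> where t: "f 8 = \<i> * of_real \<tau>" "1 < \<tau>" "\<tau>\<^sup>2 < 2" by (auto simp: twisted_def)
    have "1 < \<tau>\<^sup>2" using t(2) by (simp add: power2_eq_square less_1_mult)
    then have "0 < ((cmod (f 8))\<^sup>2 - 1) * (2 - (cmod (f 8))\<^sup>2)"
      using t by (simp add: norm_mult)
    then show ?thesis using uncountable_circle by (simp add: twisted_def 2)
  next
    case 3
    have "f 8 \<in> twisted 8 f" "f 9 \<in> twisted 9 f" using assms 3 by simp_all
    then obtain \<tau> where t: "f 8 = \<i> * of_real \<tau>" "1 < \<tau>" "\<tau>\<^sup>2 < 2"
      "(cmod (f 9))\<^sup>2 = ((cmod (f 8))\<^sup>2 - 1) * (2 - (cmod (f 8))\<^sup>2)" by (auto simp: twisted_def)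
    have "1 < \<tau>\<^sup>2" using t(2) by (simp add: power2_eq_square less_1_mult)
    then have "\<tau>\<^sup>2 \<noteq> 1" by linarith
    then have "(cmod (f 9))\<^sup>2 \<noteq> 0"
      unfolding t(4) using t(1-3) by (simp add: norm_mult)
    then have nz: "f 9 \<noteq> 0" by auto
    have "twisted i f = (\<lambda>\<beta>. of_real \<beta> / f 9) ` (UNIV - {0})" by (auto simp: twisted_def 3)
    moreover have "uncountable ((\<lambda>\<beta>. of_real \<beta> / f 9) ` (UNIV - {0}))"
      using nz uncountable_minus_countable[OF uncountable_UNIV_real, of "{0}"]
      by (subst countable_image_inj_eq) (auto simp: inj_on_def)
    ultimately show ?thesis by simp
  qed (simp add: twisted_def uncountable_Reals)
qed

lemma twisted_embedding:
  "\<exists>f :: nat \<Rightarrow> complex. (\<forall>i. f i \<in> twisted i f) \<and> (\<forall>p. insertion of_rat f p = 0 \<longrightarrow> p = 0)"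
proof (rule generic_point[of twisted])
  show "twisted i g = twisted i h" if "\<And>j. j < i \<Longrightarrow> g j = h j" for i g h
    using that[of 8] that[of 9] by (simp add: twisted_def)
qed (use twisted_uncountable in blast)+

section \<open>A conic bundle with disconnected real locus\<close>

text \<open>
  The real conic bundle \<open>w\<^sup>2 = r (y\<^sup>2 + 4 (r + 1) (r + 2) v\<^sup>2)\<close> has real points only over
  \<open>r \<in> [-2, -1]\<close> and over \<open>r \<ge> 0\<close>, which \<open>r = p / q\<close> cannot connect without passing through
  \<open>r = - 1 / 2\<close> or \<open>r = - 3\<close>.
\<close>

lemma real_conic_bundle_line:
  fixes P Q v y w :: "real poly"
  assumes eq: "Q ^ 4 * w ^ 2 = Q * P * (Q ^ 2 * y ^ 2 + 4 * (P + Q) * (P + 2 * Q) * v ^ 2)"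
    and Q: "poly Q 0 \<noteq> 0" "poly Q 1 \<noteq> 0"
    and "0 < poly P 0 / poly Q 0" "- 2 < poly P 1 / poly Q 1" "poly P 1 / poly Q 1 < - 1"
  shows "v = 0"
proof -
  have "Q \<noteq> 0" using Q by auto
  \<comment> \<open>Without the common factor, \<open>p / q\<close> is a well-defined point of the
    projective line even where \<open>q\<close> vanishes.\<close>
  then obtain p q G where G: "P = p * G" "Q = q * G" "coprime p q"
    using gcd_coprime_exists[of P Q] by auto
  have "G \<noteq> 0" using \<open>Q \<noteq> 0\<close> G by auto
  have "G ^ 4 * (q ^ 4 * w ^ 2) = G ^ 4 * (q * p * (q ^ 2 * y ^ 2 + 4 * (p + q) * (p + 2 * q) * v ^ 2))"
    using eq unfolding G by (simp add: algebra_simps power_mult_distrib power2_eq_square power4_eq_xxxx)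
  then have eq': "q ^ 4 * w ^ 2 = q * p * (q ^ 2 * y ^ 2 + 4 * (p + q) * (p + 2 * q) * v ^ 2)"
    using \<open>G \<noteq> 0\<close> by simp
  \<comment> \<open>The factors vanish at \<open>r = - 1 / 2\<close> and \<open>r = - 3\<close>. The
    homogeneous form permits zeros of \<open>q\<close>, that is, a path through infinity.\<close>
  define h where "h = (2 * p + q) * (p + 3 * q)"
  have q0: "poly q 0 \<noteq> 0" "poly q 1 \<noteq> 0" using Q G by auto
  have r: "poly P x / poly Q x = poly p x / poly q x" if "poly Q x \<noteq> 0" for x
    using that G by simp
  have h: "poly h x = (poly q x)\<^sup>2 * ((2 * (poly P x / poly Q x) + 1) * (poly P x / poly Q x + 3))"
    if "poly Q x \<noteq> 0" for x
  proof -
    have "poly q x \<noteq> 0" using that G by auto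
    then have "poly p x = poly q x * (poly P x / poly Q x)" unfolding r[OF that] by simp
    moreover have "(2 * (b * c) + b) * (b * c + 3 * b) = b\<^sup>2 * ((2 * c + 1) * (c + 3))" for b c :: real
      by (simp add: algebra_simps power2_eq_square)
    moreover have "poly h x = (2 * poly p x + poly q x) * (poly p x + 3 * poly q x)"
      by (simp add: h_def)
    ultimately show ?thesis by metis
  qed
  have "poly h 0 > 0"
    unfolding h[OF Q(1)] using q0(1) assms(4) by (intro mult_pos_pos) auto
  moreover have "poly h 1 < 0"
    unfolding h[OF Q(2)] using q0(2) assms(5,6) by (intro mult_pos_neg mult_neg_pos) auto
  ultimately obtain u where "poly h u = 0"
    using poly_IVT_neg[of 0 1 h] by auto
  then consider "poly q u = - 2 * poly p u" | "poly p u = - 3 * poly q u"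
    by (force simp: h_def)
  moreover have "poly p u \<noteq> 0 \<or> poly q u \<noteq> 0"
    using coprime_poly_0[OF G(3), of u] by auto
  \<comment> \<open>At both values \<open>r\<close> is negative, while
    \<open>(r + 1) (r + 2)\<close> is positive.\<close>
  ultimately have u: "poly q u * poly p u < 0 \<and> (poly p u + poly q u) * (poly p u + 2 * poly q u) > 0"
    by cases (auto simp: zero_less_mult_iff mult_less_0_iff)
  let ?U = "{x. poly q x * poly p x < 0} \<inter> {x. 0 < (poly p x + poly q x) * (poly p x + 2 * poly q x)}"
  have "open ?U"
    by (intro open_Int open_Collect_less continuous_intros)
  \<comment> \<open>Throughout \<open>?U\<close> the left side of \<open>eq'\<close> is nonnegative
    and the right side nonpositive, which forces \<open>v\<close> to vanish.\<close>
  have zero: "?U \<subseteq> {x. poly v x = 0}"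
  proof
    fix x assume x: "x \<in> ?U"
    have "(poly q x) ^ 4 * (poly w x)\<^sup>2 =
      poly q x * poly p x * ((poly q x)\<^sup>2 * (poly y x)\<^sup>2
        + 4 * ((poly p x + poly q x) * (poly p x + 2 * poly q x)) * (poly v x)\<^sup>2)" (is "_ = _ * ?R")
      using arg_cong[OF eq', of "\<lambda>p. poly p x"]
      by (simp only: poly_mult poly_add poly_power poly_numeral mult.assoc)
    moreover have "0 \<le> (poly q x) ^ 4 * (poly w x)\<^sup>2" by simp
    ultimately have "0 \<le> poly q x * poly p x * ?R" by (simp only:)
    moreover have "poly q x * poly p x < 0" using x by simp
    ultimately have "?R \<le> 0" by (meson linorder_not_le mult_neg_pos)
    moreover have "0 \<le> (poly q x)\<^sup>2 * (poly y x)\<^sup>2" by simp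
    ultimately have "4 * ((poly p x + poly q x) * (poly p x + 2 * poly q x)) * (poly v x)\<^sup>2 \<le> 0" by linarith
    moreover have "0 < 4 * ((poly p x + poly q x) * (poly p x + 2 * poly q x))" using x by simp
    ultimately have "\<not> 0 < (poly v x)\<^sup>2" using mult_pos_pos by (meson leD)
    then show "x \<in> {x. poly v x = 0}" by simp
  qed
  show "v = 0"
  proof (rule ccontr)
    assume "v \<noteq> 0"
    then have "countable {x. poly v x = 0}" by (intro countable_finite poly_roots_finite)
    \<comment> \<open>A nonempty open set of reals cannot consist of the finitely many roots of
      \<open>v\<close>.\<close>
    then show False
      using open_minus_countable[of "{x. poly v x = 0}" ?U] \<open>open ?U\<close> u zero by blast
  qed
qed

section \<open>Field homomorphisms and specialisation\<close>

lemma coeff_hom_field: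
  fixes E :: "'a::field \<Rightarrow> 'b::field"
  assumes "coeff_hom E"
  shows "E (a / b) = E a / E b" "E a = 0 \<longleftrightarrow> a = 0"
proof -
  interpret coeff_hom E by fact
  have inv: "E c * E (inverse c) = 1" if "c \<noteq> 0" for c
    using that hom_mult[of c "inverse c"] by simp
  show "E a = 0 \<longleftrightarrow> a = 0" using inv[of a] by (cases "a = 0") auto
  have "E (inverse b) = inverse (E b)"
    using inv[of b] by (cases "b = 0") (auto simp: inverse_unique)
  then show "E (a / b) = E a / E b" by (simp add: divide_inverse hom_mult)
qed

lemma coeff_hom_of_rat_eq:
  fixes E :: "'a::field_char_0 \<Rightarrow> 'b::field_char_0"
  assumes "coeff_hom E"
  shows "E (of_rat r) = of_rat r"
proof -
  interpret coeff_hom E by fact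
  have nat: "E (of_nat k) = of_nat k" for k by (induction k) (simp_all add: hom_add)
  have neg: "E (- a) = - E a" for a using hom_add[of a "- a"] by (simp add: eq_neg_iff_add_eq_0 add.commute)
  have int: "E (of_int k) = of_int k" for k by (cases k rule: int_cases2) (simp_all add: nat neg)
  show ?thesis
    by (cases r) (simp add: of_rat_rat coeff_hom_field[OF assms] int)
qed

lemma coeff_hom_insertion:
  fixes E :: "'a::field_char_0 \<Rightarrow> 'b::field_char_0"
  assumes "coeff_hom E"
  shows "E (insertion of_rat f p) = insertion of_rat (\<lambda>i. E (f i)) p"
proof -
  interpret coeff_hom E by fact
  have pow: "E (a ^ k) = E a ^ k" for a k by (induction k) (simp_all add: hom_mult)
  have prod: "E (prod g A) = (\<Prod>a\<in>A. E (g a))" for g and A :: "'c set"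
    by (induction A rule: infinite_finite_induct) (simp_all add: hom_mult)
  have sum: "E (sum g A) = (\<Sum>a\<in>A. E (g a))" for g and A :: "('c \<Rightarrow>\<^sub>0 nat) set"
    by (induction A rule: infinite_finite_induct) (simp_all add: hom_add)
  show ?thesis
    unfolding insertion_def monomial_eval_def sum hom_mult coeff_hom_of_rat_eq[OF assms] prod pow ..
qed

lemma of_rat_in_Reals: "of_rat r \<in> (\<real> :: complex set)"
proof -
  have "coeff_hom (of_real :: real \<Rightarrow> complex)" by unfold_locales simp_all
  from coeff_hom_of_rat_eq[OF this, of r] show ?thesis by (metis Reals_of_real)
qed

lemma insertion_in_Reals:
  "(\<And>i. i \<in> indets p \<Longrightarrow> f i \<in> \<real>) \<Longrightarrow> insertion of_rat f p \<in> (\<real> :: complex set)"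
  by (rule insertion_in_subfield)
    (auto intro!: subfield_ring_of_type_algebraI elim!: Rats_cases simp: of_rat_in_Reals)

lemma coeff_hom_Fract: "coeff_hom (\<lambda>p :: qpoly. Fract p 1)"
  by unfold_locales (simp_all add: Zero_fract_def One_fract_def)

lemma of_rat_eq_Fract: "(of_rat r :: ratfun) = Fract (const r) 1"
proof -
  have "coeff_hom (\<lambda>r. Fract (const r) 1 :: ratfun)"
    by unfold_locales (simp_all add: Zero_fract_def One_fract_def const_add const_mult)
  from coeff_hom_of_rat_eq[OF this, of r] show ?thesis by simp
qed

text \<open>On the line through two real points each polynomial becomes univariate in the parameter,
  so that \<open>real_conic_bundle_line\<close> applies.\<close>

lemma insertion_line:
  fixes e e' :: "'i \<Rightarrow> real"
  obtains l where "\<And>u. poly l u = insertion of_rat (\<lambda>i. e i + u * (e' i - e i)) p"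
proof
  show "poly (\<Sum>m\<in>Poly_Mapping.keys p. smult (of_rat (Poly_Mapping.lookup p m))
      (\<Prod>i\<in>Poly_Mapping.keys m. [:e i, e' i - e i:] ^ Poly_Mapping.lookup m i)) u
    = insertion of_rat (\<lambda>i. e i + u * (e' i - e i)) p" for u
    by (simp add: insertion_def monomial_eval_def poly_sum poly_prod)
qed

lemma common_denominator:
  fixes a :: "nat \<Rightarrow> 'a::field_char_0"
  assumes "\<And>i. i < k \<Longrightarrow> a i \<in> generate_field ring_of_type_algebra (\<rat> \<union> B)"
  obtains p q where "\<And>i. i < k \<Longrightarrow> indets (p i) \<subseteq> B" "indets q \<subseteq> B"
    "insertion of_rat (\<lambda>b. b) q \<noteq> (0::'a)"
    "\<And>i. i < k \<Longrightarrow> a i = insertion of_rat (\<lambda>b. b) (p i) / insertion of_rat (\<lambda>b. b) q"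
proof -
  let ?ev = "insertion of_rat (\<lambda>b. b) :: (('a \<Rightarrow>\<^sub>0 nat) \<Rightarrow>\<^sub>0 rat) \<Rightarrow> 'a"
  have "\<forall>i. \<exists>r s :: ('a \<Rightarrow>\<^sub>0 nat) \<Rightarrow>\<^sub>0 rat. i < k \<longrightarrow> indets r \<subseteq> B \<and> indets s \<subseteq> B \<and> ?ev s \<noteq> 0 \<and> a i = ?ev r / ?ev s"
  proof
    fix i
    show "\<exists>r s :: ('a \<Rightarrow>\<^sub>0 nat) \<Rightarrow>\<^sub>0 rat. i < k \<longrightarrow> indets r \<subseteq> B \<and> indets s \<subseteq> B \<and> ?ev s \<noteq> 0 \<and> a i = ?ev r / ?ev s"
    proof (cases "i < k")
      case True
      show ?thesis by (rule generate_field_Rats_cases[OF assms[OF True]]) blast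
    qed simp
  qed
  then obtain r s :: "nat \<Rightarrow> ('a \<Rightarrow>\<^sub>0 nat) \<Rightarrow>\<^sub>0 rat" where
    rs: "\<And>i. i < k \<Longrightarrow> indets (r i) \<subseteq> B" "\<And>i. i < k \<Longrightarrow> indets (s i) \<subseteq> B" "\<And>i. i < k \<Longrightarrow> ?ev (s i) \<noteq> 0"
      "\<And>i. i < k \<Longrightarrow> a i = ?ev (r i) / ?ev (s i)" by metis
  show ?thesis
  proof
    show "indets (r i * prod s ({..<k} - {i})) \<subseteq> B" if "i < k" for i
      using that by (intro indets_multI indets_prodI rs) auto
    show "indets (prod s {..<k}) \<subseteq> B" by (intro indets_prodI rs) auto
    show "?ev (prod s {..<k}) \<noteq> 0" using rs(3) by simp
    show "a i = ?ev (r i * prod s ({..<k} - {i})) / ?ev (prod s {..<k})" if "i < k" for i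
    proof -
      have "prod s {..<k} = s i * prod s ({..<k} - {i})"
        using that by (intro prod.remove) auto
      moreover have "(\<Prod>j\<in>{..<k} - {i}. ?ev (s j)) \<noteq> 0" using rs(3) by simp
      ultimately show ?thesis using rs(3,4)[OF that] by simp
    qed
  qed
qed

lemma conic_bundle_clear_denominators:
  fixes d :: "'a::field"
  assumes "d \<noteq> 0" "(w / d)\<^sup>2 = p / d * ((y / d)\<^sup>2 + 4 * (p / d + 1) * (p / d + 2) * (v / d)\<^sup>2)"
  shows "d ^ 4 * w ^ 2 = d * p * (d ^ 2 * y ^ 2 + 4 * (p + d) * (p + 2 * d) * v ^ 2)"
proof -
  define r w' y' v' where "r = p / d" and "w' = w / d" and "y' = y / d" and "v' = v / d"
  have e: "p = r * d" "w = w' * d" "y = y' * d" "v = v' * d"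
    using assms(1) by (simp_all add: r_def w'_def y'_def v'_def)
  have "w'\<^sup>2 = r * (y'\<^sup>2 + 4 * (r + 1) * (r + 2) * v'\<^sup>2)"
    using assms(2) unfolding r_def w'_def y'_def v'_def .
  \<comment> \<open>The sixth power combines the factor \<open>d ^ 4\<close> with the square of the
    denominator of \<open>w / d\<close>.\<close>
  then have "d ^ 6 * w'\<^sup>2 = d ^ 6 * (r * (y'\<^sup>2 + 4 * (r + 1) * (r + 2) * v'\<^sup>2))" by simp
  then show ?thesis unfolding e by (simp add: algebra_simps power2_eq_square eval_nat_numeral)
qed

text \<open>Independence turns the conic relation into a polynomial identity in the elements of
  \<open>B\<close>, which then holds for all real values of them. On the line joining the two images
  of \<open>B\<close>, \<open>real_conic_bundle_line\<close> makes the numerator of \<open>v\<close>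
  vanish, in particular at the first image; injectivity of \<open>E\<close> gives
  \<open>v = 0\<close>.\<close>

lemma conic_bundle_not_purely_transcendental:
  fixes L :: "'a::field_char_0 set" and E E' :: "'a \<Rightarrow> complex"
  assumes E: "coeff_hom E" "coeff_hom E'"
    and real: "\<And>a. a \<in> L \<Longrightarrow> E a \<in> \<real>" "\<And>a. a \<in> L \<Longrightarrow> E' a \<in> \<real>"
    and L: "r \<in> L" "v \<in> L" "y \<in> L" "w \<in> L"
    and rel: "w\<^sup>2 = r * (y\<^sup>2 + 4 * (r + 1) * (r + 2) * v\<^sup>2)" and "v \<noteq> 0"
    and sign: "Re (E r) > 0" "Re (E' r) > - 2" "Re (E' r) < - 1"
  shows "\<not> purely_transcendental \<rat> L"
proof
  assume "purely_transcendental \<rat> L"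
  then obtain B where B: "alg_independent \<rat> B" and gen: "L = generate_field ring_of_type_algebra (\<rat> \<union> B)"
    unfolding purely_transcendental_def by blast
  let ?ev = "insertion of_rat (\<lambda>b. b) :: (('a \<Rightarrow>\<^sub>0 nat) \<Rightarrow>\<^sub>0 rat) \<Rightarrow> 'a"
  have "B \<subseteq> L" unfolding gen by (auto intro: generate_field.incl)
  have mem: "([r, v, y, w] ! i) \<in> generate_field ring_of_type_algebra (\<rat> \<union> B)" if "i < 4" for i
    using L that unfolding gen by (auto simp: less_Suc_eq numeral_eq_Suc)
  obtain p q where pq: "\<And>i. i < 4 \<Longrightarrow> indets (p i) \<subseteq> B" "indets q \<subseteq> B" "?ev q \<noteq> 0"
    "\<And>i. i < 4 \<Longrightarrow> [r, v, y, w] ! i = ?ev (p i) / ?ev q"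
    by (rule common_denominator[of 4 "\<lambda>i. [r, v, y, w] ! i" B]) (use mem in blast)+
  have eqs: "r = ?ev (p 0) / ?ev q" "v = ?ev (p 1) / ?ev q" "y = ?ev (p 2) / ?ev q" "w = ?ev (p 3) / ?ev q"
    using pq(4)[of 0] pq(4)[of 1] pq(4)[of 2] pq(4)[of 3] by (simp_all add: numeral_eq_Suc)
  \<comment> \<open>Denominators are cleared because \<open>q\<close> may have zeros on the
    line.\<close>
  define z where "z = q ^ 4 * p 3 ^ 2
    - q * p 0 * (q ^ 2 * p 2 ^ 2 + 4 * (p 0 + q) * (p 0 + 2 * q) * p 1 ^ 2)"
  have "indets z \<subseteq> B"
    unfolding z_def using pq(1)[of 0] pq(1)[of 1] pq(1)[of 2] pq(1)[of 3] pq(2)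
    by (intro indets_diffI indets_multI indets_addI indets_powerI) auto
  moreover have "?ev z = 0"
    using conic_bundle_clear_denominators[OF pq(3) rel[unfolded eqs]] by (simp add: z_def)
  ultimately have z: "z = 0" using B unfolding alg_independent_Rats_iff by blast
  define e e' where "e a = Re (E a)" and "e' a = Re (E' a)" for a
  have of_real: "coeff_hom (of_real :: real \<Rightarrow> complex)" by unfold_locales simp_all
  have ev: "E (?ev s) = of_real (insertion of_rat e s)" "E' (?ev s) = of_real (insertion of_rat e' s)"
    if "indets s \<subseteq> B" for s
  proof -
    have "E b = of_real (e b)" "E' b = of_real (e' b)" if "b \<in> B" for b
      using real[of b] that \<open>B \<subseteq> L\<close> by (auto simp: e_def e'_def)
    then have "insertion of_rat E s = insertion of_rat (\<lambda>b. complex_of_real (e b)) s"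
      "insertion of_rat E' s = insertion of_rat (\<lambda>b. complex_of_real (e' b)) s"
      using that by (auto intro!: insertion_cong)
    then show "E (?ev s) = of_real (insertion of_rat e s)" "E' (?ev s) = of_real (insertion of_rat e' s)"
      using coeff_hom_insertion[OF E(1), of "\<lambda>b. b" s] coeff_hom_insertion[OF E(2), of "\<lambda>b. b" s]
      by (simp_all add: coeff_hom_insertion[OF of_real])
  qed
  define c where "c u i = e i + u * (e' i - e i)" for u i
  have "\<exists>l. \<forall>u. poly l u = insertion of_rat (c u) s" for s :: "('a \<Rightarrow>\<^sub>0 nat) \<Rightarrow>\<^sub>0 rat"
    unfolding c_def using insertion_line[of e e' s] by metis
  then obtain l where l: "\<And>s u. poly (l s) u = insertion of_rat (c u) (s :: ('a \<Rightarrow>\<^sub>0 nat) \<Rightarrow>\<^sub>0 rat)" by metis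
  have c01: "c 0 = e" "c 1 = e'" by (auto simp: c_def)
  have q01: "insertion of_rat e q \<noteq> 0" "insertion of_rat e' q \<noteq> 0"
    using ev[OF pq(2)] pq(3) coeff_hom_field(2)[OF E(1)] coeff_hom_field(2)[OF E(2)]
    by (metis of_real_0)+
  have Er: "E r = of_real (insertion of_rat e (p 0) / insertion of_rat e q)"
    "E' r = of_real (insertion of_rat e' (p 0) / insertion of_rat e' q)"
    unfolding eqs(1) coeff_hom_field[OF E(1)] coeff_hom_field[OF E(2)]
    using ev[OF pq(2)] ev[OF pq(1)[of 0]] by simp_all
  have "l (p 1) = 0"
  proof (rule real_conic_bundle_line)
    show "l q ^ 4 * l (p 3) ^ 2 = l q * l (p 0) *
        (l q ^ 2 * l (p 2) ^ 2 + 4 * (l (p 0) + l q) * (l (p 0) + 2 * l q) * l (p 1) ^ 2)"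
    proof (subst poly_eq_poly_eq_iff[symmetric], rule ext)
      fix u
      have "insertion of_rat (c u) z = 0" by (simp add: z)
      then show "poly (l q ^ 4 * l (p 3) ^ 2) u = poly (l q * l (p 0) *
        (l q ^ 2 * l (p 2) ^ 2 + 4 * (l (p 0) + l q) * (l (p 0) + 2 * l q) * l (p 1) ^ 2)) u"
        by (simp add: z_def l)
    qed
  qed (use q01 Er sign in \<open>simp_all add: l c01\<close>)
  then have "insertion of_rat e (p 1) = 0" using l[of "p 1" 0] by (simp add: c01)
  then have "E (?ev (p 1)) = 0" using ev(1)[OF pq(1)[of 1]] by simp
  then have "?ev (p 1) = 0" using coeff_hom_field(2)[OF E(1)] by blast
  then show False using \<open>v \<noteq> 0\<close> eqs(2) by simp
qed

section \<open>The field of fractions of the real invariants\<close>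

definition real_invariants :: "nat \<Rightarrow> qpoly set"
  where "real_invariants n = {p. indets p \<subseteq> {1..n} \<and> roberts p = 0 \<and>
    (\<forall>f. (\<forall>i. f i \<in> twisted i f) \<longrightarrow> insertion of_rat f p \<in> \<real>)}"

definition invariant_field :: "nat \<Rightarrow> ratfun set"
  where "invariant_field n = {Fract p q | p q. p \<in> real_invariants n \<and> q \<in> real_invariants n \<and> q \<noteq> 0}"

lemma real_invariants_closed:
  shows real_invariants_const: "const a \<in> real_invariants n"
    and real_invariants_add: "p \<in> real_invariants n \<Longrightarrow> q \<in> real_invariants n \<Longrightarrow> p + q \<in> real_invariants n"
    and real_invariants_mult: "p \<in> real_invariants n \<Longrightarrow> q \<in> real_invariants n \<Longrightarrow> p * q \<in> real_invariants n"
    and real_invariants_uminus: "p \<in> real_invariants n \<Longrightarrow> - p \<in> real_invariants n"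
  by (simp_all add: real_invariants_def roberts_add roberts_mult roberts_uminus indets_addI indets_multI
      of_rat_in_Reals)

lemma real_invariants_1: "1 \<in> real_invariants n"
  using real_invariants_const[of 1 n] by simp

lemma Fract_real_invariant: "p \<in> real_invariants n \<Longrightarrow> Fract p 1 \<in> invariant_field n"
  unfolding invariant_field_def using real_invariants_1 by force

lemma subfield_invariant_field: "subfield (invariant_field n) ring_of_type_algebra"
proof (rule subfield_ring_of_type_algebraI)
  show "1 \<in> invariant_field n"
    unfolding One_fract_def by (rule Fract_real_invariant[OF real_invariants_1])
next
  fix x assume "x \<in> invariant_field n"
  then obtain p q where "x = Fract p q" "p \<in> real_invariants n" "q \<in> real_invariants n" "q \<noteq> 0"
    unfolding invariant_field_def by blast
  then show "- x \<in> invariant_field n" "x \<noteq> 0 \<Longrightarrow> inverse x \<in> invariant_field n"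
    unfolding invariant_field_def using real_invariants_uminus by (force simp: Zero_fract_def eq_fract)+
next
  fix x y assume "x \<in> invariant_field n" "y \<in> invariant_field n"
  then obtain p q r s where "x = Fract p q" "p \<in> real_invariants n" "q \<in> real_invariants n" "q \<noteq> 0"
    "y = Fract r s" "r \<in> real_invariants n" "s \<in> real_invariants n" "s \<noteq> 0"
    unfolding invariant_field_def by blast
  then have "x + y = Fract (p * s + r * q) (q * s)" "x * y = Fract (p * r) (q * s)"
    "p * s + r * q \<in> real_invariants n" "p * r \<in> real_invariants n" "q * s \<in> real_invariants n" "q * s \<noteq> 0"
    by (simp_all add: real_invariants_add real_invariants_mult)
  then show "x + y \<in> invariant_field n" "x * y \<in> invariant_field n"
    unfolding invariant_field_def by blast+
qed

lemma Rats_subset_invariant_field: "\<rat> \<subseteq> invariant_field n"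
proof
  fix x :: ratfun assume "x \<in> \<rat>"
  then obtain r where "x = of_rat r" by (auto elim: Rats_cases)
  then show "x \<in> invariant_field n"
    using Fract_real_invariant[OF real_invariants_const] by (simp add: of_rat_eq_Fract)
qed

lemma intermediate_invariant_field: "intermediate_field n (invariant_field n)"
  unfolding intermediate_field_def
  using subfield_invariant_field Rats_subset_invariant_field
  by (auto simp: invariant_field_def rational_functions_def real_invariants_def)

text \<open>The polynomials in the field contain the algebra of invariants, and every element of the
  field is a quotient of two invariants.\<close>

lemma minimal_invariant_field: "minimal_field n (invariant_field n)"
  unfolding minimal_field_def
proof (rule antisym)
  let ?A = "(\<lambda>p. Fract p 1) ` real_invariants n"
  have "trdeg \<rat> (invariant_field n) \<le> trdeg \<rat> ?A"
  proof (rule trdeg_quotients)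
    fix x assume "x \<in> invariant_field n"
    then obtain p q where "x = Fract p q" "p \<in> real_invariants n" "q \<in> real_invariants n"
      unfolding invariant_field_def by blast
    then show "\<exists>a\<in>?A. \<exists>c\<in>?A. x = a / c" by auto
  qed
  also have "?A \<subseteq> invariant_field n \<inter> polynomials n"
    using Fract_real_invariant by (auto simp: polynomials_def real_invariants_def)
  then have "trdeg \<rat> ?A \<le> trdeg \<rat> (invariant_field n \<inter> polynomials n)" by (rule trdeg_mono)
  finally show "trdeg \<rat> (invariant_field n) \<le> trdeg \<rat> (invariant_field n \<inter> polynomials n)" .
qed (simp add: trdeg_mono)

text \<open>All coordinates of a twisted point except \<open>T\<close>, \<open>m\<close>,
  \<open>b\<close> are real, so the reality condition is automatic. This admits every kernel element
  of Roberts' derivation in the first seven variables.\<close>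

lemma real_invariantsI:
  assumes "indets p \<subseteq> {1..n}" "indets p \<inter> {8, 9, 10} = {}" "roberts p = 0"
  shows "p \<in> real_invariants n"
proof -
  have "insertion of_rat f p \<in> \<real>" if f: "\<forall>i. f i \<in> twisted i f" for f
  proof (rule insertion_in_Reals)
    show "f i \<in> \<real>" if "i \<in> indets p" for i
      using f[rule_format, of i] that assms(2) by (auto simp: twisted_def split: if_splits)
  qed
  with assms show ?thesis by (simp add: real_invariants_def)
qed

section \<open>Infinite generation\<close>

lemma bounded_part_const: "const a \<in> bounded_part N"
proof -
  have "(0 :: nat \<Rightarrow>\<^sub>0 nat) \<noteq> Poly_Mapping.single 7 (Suc k)" for k
    by (metis lookup_single_eq lookup_zero nat.distinct(1))
  moreover have "(0 :: nat \<Rightarrow>\<^sub>0 nat) \<noteq> Poly_Mapping.single 1 1 + Poly_Mapping.single 7 k" for k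
  proof
    assume "(0 :: nat \<Rightarrow>\<^sub>0 nat) = Poly_Mapping.single 1 1 + Poly_Mapping.single 7 k"
    then have "Poly_Mapping.lookup 0 1 = Poly_Mapping.lookup (Poly_Mapping.single 1 1 + Poly_Mapping.single (7::nat) k) 1"
      by simp
    then show False by (simp add: lookup_add lookup_single)
  qed
  ultimately show ?thesis by (simp add: bounded_part_def const_def lookup_single when_def)
qed

lemma not_finitely_generated:
  assumes "n \<ge> 7"
  shows "\<not> finitely_generated_algebra \<rat> (invariant_field n \<inter> polynomials n)"
proof
  let ?A = "invariant_field n \<inter> polynomials n"
  assume "finitely_generated_algebra \<rat> ?A"
  then obtain S where S: "finite S" "?A = generate_ring ring_of_type_algebra (\<rat> \<union> S)"
    unfolding finitely_generated_algebra_def by blast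
  \<comment> \<open>If \<open>a = p * b\<close> with \<open>a\<close> and \<open>b\<close> in the
    kernel, the product rule leaves \<open>roberts p * b = 0\<close>.\<close>
  have kernel: "\<exists>p. x = Fract p 1 \<and> roberts p = 0" if x: "x \<in> ?A" for x
  proof -
    obtain a b where ab: "x = Fract a b" "roberts a = 0" "roberts b = 0" "b \<noteq> 0"
      using x unfolding invariant_field_def real_invariants_def by auto
    obtain p where p: "x = Fract p 1" using x unfolding polynomials_def by blast
    then have "a = p * b" using ab by (simp add: eq_fract)
    then have "roberts p * b = 0" using ab(2,3) by (simp add: roberts_mult)
    with p ab(4) show ?thesis by auto
  qed
  have "S \<subseteq> ?A" unfolding S(2) by (auto intro: generate_ring.incl)
  then have "\<forall>x\<in>S. \<exists>p. x = Fract p 1 \<and> roberts p = 0" using kernel by blast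
  then obtain P where P: "\<And>x. x \<in> S \<Longrightarrow> x = Fract (P x) 1" "\<And>x. x \<in> S \<Longrightarrow> roberts (P x) = 0" by metis
  \<comment> \<open>The exponents of \<open>v\<close> in the finitely many generators have a bound
    \<open>N\<close>. It places the generators, and then the whole algebra, in
    \<open>bounded_part N\<close>.\<close>
  define M where "M = (\<Union>x\<in>S. (\<lambda>m. Poly_Mapping.lookup m 7) ` Poly_Mapping.keys (P x))"
  have "finite M" unfolding M_def using S(1) by simp
  then obtain N where N: "\<And>k. k \<in> M \<Longrightarrow> k \<le> N" by (meson finite_nat_set_iff_bounded_le)
  have PN: "P x \<in> bounded_part N" if "x \<in> S" for x
  proof -
    have "Poly_Mapping.lookup (P x) (Poly_Mapping.single 1 1 + Poly_Mapping.single 7 k) = 0" if "k > N" for k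
    proof (rule ccontr)
      assume "Poly_Mapping.lookup (P x) (Poly_Mapping.single 1 1 + Poly_Mapping.single 7 k) \<noteq> 0"
      then have "Poly_Mapping.single 1 1 + Poly_Mapping.single 7 k \<in> Poly_Mapping.keys (P x)"
        by (simp add: in_keys_iff)
      then have "Poly_Mapping.lookup (Poly_Mapping.single 1 1 + Poly_Mapping.single 7 k) (7::nat) \<in> M"
        unfolding M_def using \<open>x \<in> S\<close> by (intro UN_I[of x] imageI)
      then show False using N[of k] that by (simp add: lookup_add lookup_single)
    qed
    then show ?thesis
      using roberts_kernel_coeff[OF P(2)[OF that]] by (simp add: bounded_part_def)
  qed
  have gen: "\<exists>p\<in>bounded_part N. x = Fract p 1" if "x \<in> generate_ring ring_of_type_algebra (\<rat> \<union> S)" for x :: ratfun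
    using that
  proof induction
    case one
    then show ?case
      by (intro bexI[of _ 1]) (use bounded_part_const[of 1 N] in \<open>simp_all add: One_fract_def\<close>)
  next
    case (incl x)
    then show ?case
    proof
      assume "x \<in> \<rat>"
      then obtain r where r: "x = of_rat r" by (auto elim: Rats_cases)
      have "x = Fract (const r) 1" unfolding r by (rule of_rat_eq_Fract)
      then show ?case using bounded_part_const by blast
    qed (use P PN in blast)
  next
    case (a_inv x)
    then obtain p where "p \<in> bounded_part N" "x = Fract p 1" by blast
    then show ?case by (intro bexI[of _ "- p"]) (auto simp: bounded_part_def)
  next
    case (eng_add x y)
    then obtain p q where "p \<in> bounded_part N" "x = Fract p 1" "q \<in> bounded_part N" "y = Fract q 1" by blast
    then show ?case by (intro bexI[of _ "p + q"]) (auto simp: bounded_part_def lookup_add)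
  next
    case (eng_mult x y)
    then obtain p q where "p \<in> bounded_part N" "x = Fract p 1" "q \<in> bounded_part N" "y = Fract q 1" by blast
    then show ?case using bounded_part_mult by (intro bexI[of _ "p * q"]) auto
  qed
  \<comment> \<open>The exponent \<open>N + 1\<close> of \<open>v\<close> lies just beyond the
    bound.\<close>
  obtain f where f: "roberts f = 0" "indets f \<subseteq> {1..7}"
    "Poly_Mapping.lookup f (Poly_Mapping.single 1 1 + Poly_Mapping.single 7 (Suc N)) \<noteq> 0"
    by (rule roberts_kernel_element)
  have "indets f \<subseteq> {1..n}" using f(2) assms by fastforce
  moreover have "indets f \<inter> {8, 9, 10} = {}" using f(2) by fastforce
  ultimately have "Fract f 1 \<in> ?A"
    using Fract_real_invariant[OF real_invariantsI[OF _ _ f(1)]] by (auto simp: polynomials_def)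
  then obtain p where p: "p \<in> bounded_part N" "Fract f 1 = Fract p 1"
    using gen unfolding S(2) by blast
  then have "f = p" by (simp add: eq_fract)
  with p(1) f(3) show False by (simp add: bounded_part_def)
qed

section \<open>Irrationality\<close>

lemma var_neq_0: "var i \<noteq> (0 :: ('i \<Rightarrow>\<^sub>0 nat) \<Rightarrow>\<^sub>0 'c::comm_ring_1)"
proof
  assume "var i = (0 :: ('i \<Rightarrow>\<^sub>0 nat) \<Rightarrow>\<^sub>0 'c)"
  then have "Poly_Mapping.lookup (var i) (Poly_Mapping.single i 1) = (0 :: 'c)" by simp
  then show False by (simp add: var_def)
qed

text \<open>The product \<open>f 9 * cnj (f 9)\<close> is the value of
  \<open>g = - (r + 1) (r + 2)\<close> at \<open>r = T^2 = - \<tau>^2\<close>, so the conjugate of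
  \<open>m\<close> is \<open>g / m\<close>.\<close>

lemma twisted_values:
  assumes f: "\<And>i. f i \<in> twisted i f"
  obtains \<tau> \<beta> where "f 8 = \<i> * of_real \<tau>" "1 < \<tau>\<^sup>2" "\<tau>\<^sup>2 < 2" "f 10 * f 9 = of_real \<beta>"
    "f 9 * cnj (f 9) = of_real ((\<tau>\<^sup>2 - 1) * (2 - \<tau>\<^sup>2))" "f 9 \<noteq> 0" 
proof -
  obtain \<tau> where t: "f 8 = \<i> * of_real \<tau>" "1 < \<tau>" "\<tau>\<^sup>2 < 2" using f[of 8] by (auto simp: twisted_def)
  have t1: "1 < \<tau>\<^sup>2" using t(2) by (simp add: power2_eq_square less_1_mult)
  obtain \<beta> where b: "f 10 = of_real \<beta> / f 9" using f[of 10] by (auto simp: twisted_def)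
  have m: "(cmod (f 9))\<^sup>2 = (\<tau>\<^sup>2 - 1) * (2 - \<tau>\<^sup>2)"
    using f[of 9] t(1) by (simp add: twisted_def norm_mult)
  have "0 < (\<tau>\<^sup>2 - 1) * (2 - \<tau>\<^sup>2)" using t(3) t1 by (intro mult_pos_pos) simp_all
  then have nz: "f 9 \<noteq> 0" using m by auto
  show ?thesis
    by (rule that[OF t(1) t1 t(3), of \<beta>]) (use nz b m in \<open>simp_all add: complex_norm_square[symmetric]\<close>)
qed

lemma not_purely_transcendental_invariant_field:
  assumes "n \<ge> 10"
  shows "\<not> purely_transcendental \<rat> (invariant_field n)"
proof -
  define r v g y w :: qpoly where "r = var 8 ^ 2" and "v = var 10 * var 9"
    and "g = - ((r + 1) * (r + 2))" and "y = var 10 * (var 9 ^ 2 + g)"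
    and "w = var 8 * var 10 * (var 9 ^ 2 - g)"
  \<comment> \<open>Roberts' derivation differentiates only with respect to the variables 4 to 7, so
    \<open>T\<close>, \<open>m\<close>, \<open>b\<close> are constants for it.\<close>
  have rb: "roberts r = 0" "roberts v = 0" "roberts y = 0" "roberts w = 0"
  proof -
    have v0: "roberts (var 8) = 0" "roberts (var 9) = 0" "roberts (var 10) = 0" by (simp_all add: roberts_var)
    then show r: "roberts r = 0" and "roberts v = 0" by (simp_all add: r_def v_def roberts_power roberts_mult)
    have "roberts 2 = 0" using roberts_const[of 2] by (simp add: const_def)
    with r have "roberts g = 0" by (simp add: g_def roberts_uminus roberts_mult roberts_add)
    with v0 show "roberts y = 0" "roberts w = 0"
      by (simp_all add: y_def w_def roberts_mult roberts_add roberts_power roberts_uminus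
          diff_conv_add_uminus del: add_uminus_conv_diff)
  qed
  have ind: "indets q \<subseteq> {1..n}" if "q \<in> {r, v, y, w}" for q
  proof -
    have r: "indets r \<subseteq> {1..n}" unfolding r_def using assms by (intro indets_powerI) auto
    have g: "indets g \<subseteq> {1..n}" unfolding g_def indets_uminus using r by (intro indets_multI indets_addI) auto
    have "indets v \<subseteq> {1..n}" unfolding v_def using assms by (intro indets_multI) auto
    moreover have "indets y \<subseteq> {1..n}" unfolding y_def using assms g
      by (intro indets_multI indets_addI indets_powerI) auto
    moreover have "indets w \<subseteq> {1..n}" unfolding w_def using assms g
      by (intro indets_multI indets_diffI indets_powerI) auto
    ultimately show ?thesis using r that by auto
  qed
  have inv: "insertion of_rat f q \<in> \<real>" if f: "\<forall>i. f i \<in> twisted i f" and "q \<in> {r, v, y, w}" for f q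
  proof -
    obtain \<tau> \<beta> where t: "f 8 = \<i> * of_real \<tau>" "1 < \<tau>\<^sup>2" "\<tau>\<^sup>2 < 2" "f 10 * f 9 = of_real \<beta>"
      "f 9 * cnj (f 9) = of_real ((\<tau>\<^sup>2 - 1) * (2 - \<tau>\<^sup>2))" "f 9 \<noteq> 0"
      using twisted_values[of f] f by blast
    have r: "insertion of_rat f r = - of_real (\<tau>\<^sup>2)" by (simp add: r_def t(1) power_mult_distrib)
    \<comment> \<open>With this value of \<open>g\<close>, \<open>y\<close> becomes
      \<open>b m\<close> times twice the real part of \<open>m\<close>, and \<open>w\<close> becomes
      \<open>b m\<close> times a real multiple of its imaginary part.\<close>
    have g: "insertion of_rat f g = f 9 * cnj (f 9)"
      unfolding g_def t(5) by (simp add: r algebra_simps)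
    have y: "insertion of_rat f y = f 10 * f 9 * (f 9 + cnj (f 9))"
      by (simp add: y_def g algebra_simps power2_eq_square)
    have w: "insertion of_rat f w = f 10 * f 9 * of_real \<tau> * (\<i> * (f 9 - cnj (f 9)))"
      by (simp add: w_def g t(1) algebra_simps power2_eq_square)
    have v: "insertion of_rat f v = of_real \<beta>" by (simp add: v_def t(4))
    have "f 9 + cnj (f 9) \<in> \<real>" "\<i> * (f 9 - cnj (f 9)) \<in> \<real>"
      by (simp_all add: complex_is_Real_iff)
    with that(2) show ?thesis unfolding insert_iff
      by (auto simp: r v y w t(4) simp del: of_real_power)
  qed
  have mem: "Fract q 1 \<in> invariant_field n" if "q \<in> {r, v, y, w}" for q
    using that ind[OF that] rb inv by (intro Fract_real_invariant) (auto simp: real_invariants_def)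
  obtain f :: "nat \<Rightarrow> complex" where "\<forall>i. f i \<in> \<real>" "\<forall>p. insertion of_rat f p = 0 \<longrightarrow> p = 0"
    using real_embedding by (elim exE conjE)
  then have f: "f i \<in> \<real>" "insertion of_rat f p = 0 \<Longrightarrow> p = 0" for i p by auto
  obtain f' :: "nat \<Rightarrow> complex" where "\<forall>i. f' i \<in> twisted i f'" "\<forall>p. insertion of_rat f' p = 0 \<longrightarrow> p = 0"
    using twisted_embedding by (elim exE conjE)
  then have f': "f' i \<in> twisted i f'" "insertion of_rat f' p = 0 \<Longrightarrow> p = 0" for i p by auto
  obtain E where E: "coeff_hom E" "\<And>p q. q \<noteq> 0 \<Longrightarrow> E (Fract p q) = insertion of_rat f p / insertion of_rat f q"
    using generic_embedding[OF f(2)] by metis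
  obtain E' where E': "coeff_hom E'" "\<And>p q. q \<noteq> 0 \<Longrightarrow> E' (Fract p q) = insertion of_rat f' p / insertion of_rat f' q"
    using generic_embedding[OF f'(2)] by metis
  have Reals: "insertion of_rat f p \<in> \<real>" for p :: qpoly
    using f(1) by (rule insertion_in_Reals)
  show ?thesis
  proof (rule conic_bundle_not_purely_transcendental[OF E(1) E'(1), of _ "Fract r 1" "Fract v 1" "Fract y 1" "Fract w 1"])
    show "E a \<in> \<real>" if "a \<in> invariant_field n" for a
      using that Reals unfolding invariant_field_def by (auto simp: E(2))
    show "E' a \<in> \<real>" if "a \<in> invariant_field n" for a
      using that f'(1) unfolding invariant_field_def real_invariants_def by (auto simp: E'(2))
    \<comment> \<open>This is \<open>(m^2 - g)^2 = (m^2 + g)^2 - 4 g m^2\<close> multiplied by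
      \<open>T^2 b^2\<close>.\<close>
    have "w\<^sup>2 = r * (y\<^sup>2 + 4 * (r + 1) * (r + 2) * v\<^sup>2)"
    proof -
      have "w\<^sup>2 = r * (y\<^sup>2 - 4 * g * v\<^sup>2)"
        unfolding w_def y_def v_def r_def power2_eq_square by (simp add: algebra_simps)
      moreover have "y\<^sup>2 - 4 * g * v\<^sup>2 = y\<^sup>2 + 4 * (r + 1) * (r + 2) * v\<^sup>2"
        by (simp only: g_def mult_minus_left mult_minus_right diff_minus_eq_add mult.assoc)
      ultimately show ?thesis by (simp only:)
    qed
    then have eq: "Fract (w\<^sup>2) 1 = Fract (r * (y\<^sup>2 + 4 * (r + 1) * (r + 2) * v\<^sup>2)) 1" by simp
    interpret Fract: coeff_hom "\<lambda>p :: qpoly. Fract p 1" by (rule coeff_hom_Fract)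
    have num: "Fract 4 1 = (4 :: ratfun)" "Fract 2 1 = (2 :: ratfun)"
      using Fract_of_nat_eq[of 4] Fract_of_nat_eq[of 2] by simp_all
    show "(Fract w 1)\<^sup>2 = Fract r 1 * ((Fract y 1)\<^sup>2 + 4 * (Fract r 1 + 1) * (Fract r 1 + 2) * (Fract v 1)\<^sup>2)"
      using eq unfolding power2_eq_square Fract.hom_mult Fract.hom_add Fract.hom_1 num .
    have "v \<noteq> 0"
      by (simp add: v_def var_neq_0)
    then show "Fract v 1 \<noteq> 0" unfolding Zero_fract_def by (subst eq_fract) simp_all
    \<comment> \<open>At the real point \<open>r\<close> is the square of a real number, which is
      nonzero by genericity.\<close>
    have "f 8 \<noteq> 0"
    proof
      assume "f 8 = 0"
      then have "insertion of_rat f (var 8) = 0" by simp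
      then have "(var 8 :: qpoly) = 0" by (rule f(2))
      then show False by (simp add: var_neq_0)
    qed
    then show "0 < Re (E (Fract r 1))"
      using f(1)[of 8] by (auto simp: E(2) r_def elim!: Reals_cases)
    \<comment> \<open>At the twisted point \<open>r = - \<tau>^2\<close>, with
      \<open>\<tau>^2\<close> strictly between 1 and 2.\<close>
    obtain \<tau> \<beta> where t: "f' 8 = \<i> * of_real \<tau>" "1 < \<tau>\<^sup>2" "\<tau>\<^sup>2 < 2"
      using twisted_values[of f'] f'(1) by metis
    then show "- 2 < Re (E' (Fract r 1))" "Re (E' (Fract r 1)) < - 1"
      by (simp_all add: E'(2) r_def power_mult_distrib)
  qed (use mem in auto)
qed

theorem mainTheorem5:
  fixes n :: nat
  assumes "n \<ge> 48"
  shows "\<exists>L. intermediate_field n L \<and>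
             minimal_field n L \<and>
             \<not> purely_transcendental \<rat> L \<and>
             \<not> finitely_generated_algebra \<rat> (L \<inter> polynomials n)"
  using assms intermediate_invariant_field[of n] minimal_invariant_field[of n]
    not_purely_transcendental_invariant_field[of n] not_finitely_generated[of n]
  by (intro exI[of _ "invariant_field n"]) simp

end
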